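(* For an integer $n\geq 3$, let $\pi_n^{(3)}$ denote the probability that, if two $n$-cycles $u,v$ are chosen independently and uniformly at random from the symmetric group $\mathfrak{S}_n$ of permutations of $\{1,2,\dots,n\}$, then $1$, $2$ and $3$ all lie in the same cycle of the product $uv$. Then $$\pi_n^{(3)}=\begin{cases}\frac13+\frac{1}{(n-2)(n+3)}, & n \text{ odd},\\[.3em] \frac13-\frac{3}{(n-1)(n+2)}, & n\text{ even}.\end{cases}$$
   Context: An $n$-cycle in $\mathfrak{S}_n$ is a permutation consisting of a single cycle of length $n$. *)

theory Defs
  imports
    "HOL-Probability.Probability"
    "HOL-Combinatorics.Orbits"
begin

definition n_cycles :: "nat \<Rightarrow> (nat \<Rightarrow> nat) set" where
  "n_cycles n = {p. p permutes {1..n} \<and> cyclic_on p {1..n}}"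

(* The cycles of a permutation p, fixed points included, are the sets C with cyclic_on p C. *)
definition in_same_cycle :: "('a \<Rightarrow> 'a) \<Rightarrow> 'a set \<Rightarrow> bool" where
  "in_same_cycle p A \<longleftrightarrow> (\<exists>C. cyclic_on p C \<and> A \<subseteq> C)"

(* n_cycles n is finite, and nonempty for n > 0, so pmf_of_set is the uniform distribution on it;
   pair_pmf makes the two choices independent. *)
definition pi3 :: "nat \<Rightarrow> real" where
  "pi3 n = measure_pmf.prob
     (pair_pmf (pmf_of_set (n_cycles n)) (pmf_of_set (n_cycles n)))
     {(u, v). in_same_cycle (u \<circ> v) {1, 2, 3}}"

end

theory Submission
  imports Defs
begin

text \<open>
  By Boccara's formula the number of ways to write a permutation of n points with cycle lengths
  \<open>l\<^sub>1, l\<^sub>2, \<dots>\<close> as a product of two n-cycles is (n - 1)! times the integral over [0, 1] of the product of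
  the polynomials \<open>x\<^sup>l - (x - 1)\<^sup>l\<close>. It follows by induction on n: every n-cycle arises uniquely
  from a cycle on n - 1 points by inserting the point n, so the number of factorizations of w is a
  sum over permutations of n - 1 points that are obtained from w by removing n and then splitting or
  merging cycles with a transposition. The integrals satisfy the same recursion because the
  two sides differ by the derivative of a polynomial that vanishes at 0 and 1.

  Summing Boccara's formula over all w with 1, 2, 3 in one cycle, by contracting the successor of 1
  in its cycle, leaves a Beta integral, that is, an alternating sum of reciprocals of
  binomial coefficients, which telescopes.
\<close>

hide_const (open) Finite_Cartesian_Product.transpose

section \<open>Cycles under multiplication by a transposition\<close>

text \<open>Removing \<open>n\<close> from both factors of \<open>w\<close> is delicate: with
  factors \<open>transpose b n \<circ> u\<close> and \<open>v \<circ> transpose a n\<close> the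
  product \<open>u \<circ> v\<close> equals
  \<open>transpose b n \<circ> w \<circ> transpose a n\<close>, which has to fix \<open>n\<close>,
  and this forces \<open>b = w a\<close>. So one factor receives its transposition on the left, the
  other on the right, and a single free parameter \<open>a\<close> remains. If \<open>w\<close>
  arises from \<open>p\<close> by inserting \<open>n\<close> after \<open>m\<close>, the reduced
  products are \<open>p \<circ> transpose a m\<close> with \<open>a \<noteq> m\<close>. On the side
  of the integrals this asks for the sum of the weights over all ways to split the cycle of
  \<open>m\<close> or to merge it with another one; the derivative of
  \<open>polyX * polyY * hpoly L * R\<close> is exactly the defect.

  In the summation the cycle of the point 1 carries an arbitrary weight \<open>g\<close> instead of
  \<open>hpoly\<close>: contracting a point of that cycle turns \<open>g\<close> into
  \<open>g \<circ> Suc\<close>, which leaves the polynomials of Boccara's formula.\<close>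

lemma cyclic_on_image_atMost:
  assumes step: "\<And>i. i < k \<Longrightarrow> p (f i) = f (Suc i)" and last: "p (f k) = f 0"
  shows "cyclic_on p (f ` {..k})"
proof -
  have Suc_in: "Suc i \<le> k \<Longrightarrow> f (Suc i) \<in> orbit p (f 0)" for i
  proof (induction i)
    case 0
    then show ?case using step[of 0] orbit.base[of p "f 0"] by simp
  next
    case (Suc i)
    then show ?case using step[of "Suc i"] orbit.step[of "f (Suc i)" p "f 0"] by simp
  qed
  have zero_in: "f 0 \<in> orbit p (f 0)"
  proof (cases k)
    case 0
    then show ?thesis using last orbit.base[of p "f 0"] by simp
  next
    case (Suc j)
    then show ?thesis using last Suc_in[of j] orbit.step[of "f k" p "f 0"] by simp
  qed
  have "f ` {..k} \<subseteq> orbit p (f 0)"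
    using zero_in Suc_in by (metis atMost_iff image_subsetI not0_implies_Suc)
  moreover have "x \<in> f ` {..k}" if "x \<in> orbit p (f 0)" for x
    using that
  proof induction
    case base
    then show ?case using step[of 0] last by (cases "k = 0") auto
  next
    case (step y)
    then obtain i where i: "i \<le> k" "y = f i" by auto
    show ?case
    proof (cases "i = k")
      case True
      then show ?thesis using i last by auto
    next
      case False
      then have "p y = f (Suc i)" "Suc i \<le> k" using i assms(1)[of i] by auto
      then show ?thesis by auto
    qed
  qed
  ultimately have "f ` {..k} = orbit p (f 0)" by auto
  then show ?thesis unfolding cyclic_on_def by (metis atMost_iff imageI le0)
qed

lemma cyclic_on_enum:
  assumes "cyclic_on p C" "m \<in> C"
  shows "(p ^^ card C) m = m" and "inj_on (\<lambda>i. (p ^^ i) m) {..<card C}"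
    and "(\<lambda>i. (p ^^ i) m) ` {..<card C} = C" and "0 < card C"
proof -
  define d where "d = funpow_dist1 p m m"
  have C: "orbit p m = C" using assms by (rule orbit_cyclic_eq3)
  have m: "m \<in> orbit p m" using C assms by simp
  have im: "C = (\<lambda>i. (p ^^ i) m) ` {..<d}"
    using orbit_conv_funpow_dist1[OF m] C by (simp add: d_def lessThan_atLeast0)
  have inj: "inj_on (\<lambda>i. (p ^^ i) m) {..<d}"
    using inj_on_funpow_dist1[OF m] by (simp add: d_def lessThan_atLeast0)
  have d: "card C = d" using im inj card_image by fastforce
  show "(p ^^ card C) m = m" using funpow_dist1_prop[OF m] by (simp add: d d_def)
  show "inj_on (\<lambda>i. (p ^^ i) m) {..<card C}" using inj d by simp
  show "(\<lambda>i. (p ^^ i) m) ` {..<card C} = C" using im d by simp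
  show "0 < card C" by (simp add: d d_def)
qed

text \<open>Multiplication by \<open>transpose a m\<close> on the right changes the step that leaves
  \<open>m\<close>. Starting the enumeration at \<open>p m\<close> puts \<open>m\<close> last, so
  that the changed step is the closing one.\<close>

lemma cyclic_on_enum_Suc:
  assumes "cyclic_on p C" "m \<in> C"
  shows "inj_on (\<lambda>i. (p ^^ Suc i) m) {..<card C}"
    and "(\<lambda>i. (p ^^ Suc i) m) ` {..<card C} = C"
proof -
  have pm: "p m \<in> C" using assms by (rule cyclic_on_inI)
  have eq: "(\<lambda>i. (p ^^ Suc i) m) = (\<lambda>i. (p ^^ i) (p m))"
    by (simp add: funpow_swap1)
  show "inj_on (\<lambda>i. (p ^^ Suc i) m) {..<card C}" "(\<lambda>i. (p ^^ Suc i) m) ` {..<card C} = C"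
    unfolding eq using cyclic_on_enum[OF assms(1) pm] by auto
qed

lemma lessThan_add_eq_image: "{..<a + b} = {..<a} \<union> (\<lambda>i. a + i) ` {..<b}" for a b :: nat
proof (intro equalityI subsetI)
  fix x assume x: "x \<in> {..<a + b}"
  show "x \<in> {..<a} \<union> (\<lambda>i. a + i) ` {..<b}"
  proof (cases "x < a")
    case False
    then have "x = a + (x - a)" "x - a \<in> {..<b}" using x by auto
    then show ?thesis by blast
  qed simp
qed auto

text \<open>The product exchanges the successors of \<open>a\<close> and \<open>m\<close>: the walk
  runs through \<open>C\<close> from \<open>p m\<close> to \<open>m\<close>, jumps to
  \<open>p a\<close>, runs through \<open>D\<close> to \<open>a\<close> and returns to
  \<open>p m\<close>.\<close>

lemma cyclic_on_merge:
  assumes C: "cyclic_on p C" "m \<in> C" and D: "cyclic_on p D" "a \<in> D" and disj: "C \<inter> D = {}"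
  shows "cyclic_on (p \<circ> transpose a m) (C \<union> D)"
proof -
  define c d where "c = card C" and "d = card D"
  note eC = cyclic_on_enum[OF C, folded c_def] cyclic_on_enum_Suc[OF C, folded c_def]
  note eD = cyclic_on_enum[OF D, folded d_def] cyclic_on_enum_Suc[OF D, folded d_def]
  define f where "f i = (if i < c then (p ^^ Suc i) m else (p ^^ Suc (i - c)) a)" for i
  have inC: "(p ^^ Suc i) m \<in> C" for i using C by (rule cyclic_on_funpow_in)
  have inD: "(p ^^ Suc i) a \<in> D" for i using D by (rule cyclic_on_funpow_in)
  have neC: "(p ^^ Suc i) m \<noteq> m" if "Suc i < c" for i
    using inj_onD[OF eC(2), of 0 "Suc i"] that by auto
  have neD: "(p ^^ Suc i) a \<noteq> a" if "Suc i < d" for i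
    using inj_onD[OF eD(2), of 0 "Suc i"] that by auto
  have "f ` {..c + d - 1} = C \<union> D"
  proof -
    have "{..c + d - 1} = {..<c + d}" using eC(4) by auto
    then have split: "{..c + d - 1} = {..<c} \<union> (\<lambda>i. c + i) ` {..<d}"
      by (simp only: lessThan_add_eq_image)
    have 1: "f ` {..<c} = (\<lambda>i. (p ^^ Suc i) m) ` {..<c}"
      by (rule image_cong) (auto simp: f_def)
    have 2: "f ` (\<lambda>i. c + i) ` {..<d} = (\<lambda>i. (p ^^ Suc i) a) ` {..<d}"
      unfolding image_image by (rule image_cong) (auto simp: f_def)
    show ?thesis unfolding split image_Un 1 2 eC(6) eD(6) by simp
  qed
  moreover have "cyclic_on (p \<circ> transpose a m) (f ` {..c + d - 1})"
  proof (rule cyclic_on_image_atMost)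
    fix i assume i: "i < c + d - 1"
    consider "Suc i < c" | "Suc i = c" | "c \<le> i" by linarith
    then show "(p \<circ> transpose a m) (f i) = f (Suc i)"
    proof cases
      case 1
      then have "f i \<noteq> m" "f i \<noteq> a"
        using neC[of i] inC[of i] D(2) disj by (auto simp: f_def)
      then show ?thesis using 1 by (simp add: f_def)
    next
      case 2
      then have "f i = m" using eC(1) by (auto simp: f_def)
      then show ?thesis using 2 by (simp add: f_def)
    next
      case 3
      have "Suc (i - c) < d" using 3 i by linarith
      then have "f i \<noteq> m" "f i \<noteq> a"
        using 3 neD[of "i - c"] inD[of "i - c"] C(2) disj by (auto simp: f_def)
      then show ?thesis using 3 by (simp add: f_def Suc_diff_le)
    qed
  next
    have "c + d - 1 - c = d - 1" "\<not> c + d - 1 < c" using eD(4) by auto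
    then have "f (c + d - 1) = (p ^^ Suc (d - 1)) a" unfolding f_def by presburger
    also have "\<dots> = a" using eD(1,4) by (metis Suc_pred')
    finally have "f (c + d - 1) = a" .
    then show "(p \<circ> transpose a m) (f (c + d - 1)) = f 0" using eC(4) by (simp add: f_def)
  qed
  ultimately show ?thesis by simp
qed

text \<open>With \<open>a = (p ^^ j) m\<close>, the product sends \<open>a\<close> back to
  \<open>p m\<close>, which closes the arc \<open>A\<close> after \<open>j\<close> points, and sends
  \<open>m\<close> to \<open>p a\<close>, which closes the remaining arc from \<open>p a\<close> to
  \<open>m\<close>.\<close>

lemma cyclic_on_split:
  assumes C: "cyclic_on p C" "m \<in> C" and j: "0 < j" "j < card C"
  defines "A \<equiv> (\<lambda>i. (p ^^ Suc i) m) ` {..<j}"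
  shows "cyclic_on (p \<circ> transpose ((p ^^ j) m) m) A"
    and "cyclic_on (p \<circ> transpose ((p ^^ j) m) m) (C - A)"
    and "A \<subseteq> C" and "card A = j"
proof -
  define c where "c = card C"
  define f where "f i = (p ^^ Suc i) m" for i
  note eC = cyclic_on_enum[OF C, folded c_def] cyclic_on_enum_Suc[OF C, folded c_def, folded f_def]
  have jc: "j < c" using j c_def by simp
  define a where "a = (p ^^ j) m"
  have fj: "f (j - 1) = a" using j by (simp add: f_def a_def flip: funpow.simps(2))
  have fc: "f (c - 1) = m" using eC(1,4) by (simp add: f_def flip: funpow.simps(2))
  have pf: "p (f i) = f (Suc i)" for i by (simp add: f_def)
  have inj: "f i = f k \<longleftrightarrow> i = k" if "i < c" "k < c" for i k
    using inj_onD[OF eC(5)] that by auto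
  have A: "A = f ` {..j - 1}"
    unfolding A_def f_def using j by (intro image_cong) auto
  have "{..<j} = {..j - 1}" "{..<c - j} = {..c - j - 1}" using j jc by auto
  then have "{..<c} = {..j - 1} \<union> (\<lambda>i. j + i) ` {..c - j - 1}"
    using lessThan_add_eq_image[of j "c - j"] jc by simp
  then have "C = A \<union> (\<lambda>i. f (j + i)) ` {..c - j - 1}"
    using eC(6) A by (simp add: image_Un image_image)
  moreover have "A \<inter> (\<lambda>i. f (j + i)) ` {..c - j - 1} = {}"
    unfolding A using inj j jc by fastforce
  ultimately have CA: "C - A = (\<lambda>i. f (j + i)) ` {..c - j - 1}" and "A \<subseteq> C" by auto
  show "A \<subseteq> C" by fact
  have "inj_on f {..<j}" using eC(5) jc by (auto intro: inj_on_subset)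
  then show "card A = j" unfolding A_def f_def[symmetric] by (simp add: card_image)
  show "cyclic_on (p \<circ> transpose ((p ^^ j) m) m) A"
    unfolding A a_def[symmetric]
  proof (rule cyclic_on_image_atMost)
    fix i assume "i < j - 1"
    then have "f i \<noteq> a" "f i \<noteq> m"
      using inj[of i "j - 1"] inj[of i "c - 1"] jc unfolding fj fc by linarith+
    then show "(p \<circ> transpose a m) (f i) = f (Suc i)" by (simp add: pf)
  next
    have "p m = f 0" by (simp add: f_def)
    then show "(p \<circ> transpose a m) (f (j - 1)) = f 0" unfolding fj by simp
  qed
  show "cyclic_on (p \<circ> transpose ((p ^^ j) m) m) (C - A)"
    unfolding CA a_def[symmetric]
  proof (rule cyclic_on_image_atMost)
    fix i assume "i < c - j - 1"
    then have "f (j + i) \<noteq> a" "f (j + i) \<noteq> m"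
      using inj[of "j + i" "j - 1"] inj[of "j + i" "c - 1"] jc j unfolding fj fc by linarith+
    then show "(p \<circ> transpose a m) (f (j + i)) = f (j + Suc i)" by (simp add: pf)
  next
    have "j + (c - j - 1) = c - 1" using jc by simp
    then have "f (j + (c - j - 1)) = m" using fc by metis
    moreover have "p a = f j" using j pf[of "j - 1"] unfolding fj by simp
    ultimately show "(p \<circ> transpose a m) (f (j + (c - j - 1))) = f (j + 0)" by simp
  qed
qed

section \<open>The set of cycles of a permutation and its change under a transposition\<close>

definition cycles :: "('a \<Rightarrow> 'a) \<Rightarrow> 'a set \<Rightarrow> 'a set set" where
  "cycles p S = orbit p ` S"

lemma cycles_eqI:
  assumes "\<And>C. C \<in> P \<Longrightarrow> cyclic_on p C" and "\<Union>P = S"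
  shows "cycles p S = P"
proof -
  have orbit: "orbit p x = C" if "C \<in> P" "x \<in> C" for x C
    using orbit_cyclic_eq3[OF assms(1)] that by blast
  show ?thesis
    unfolding cycles_def
  proof (intro equalityI subsetI)
    fix C assume "C \<in> orbit p ` S"
    then show "C \<in> P" using orbit assms(2) by blast
  next
    fix C assume C: "C \<in> P"
    then obtain x where "x \<in> C" using assms(1) unfolding cyclic_on_def by blast
    then show "C \<in> orbit p ` S" using orbit C assms(2) by blast
  qed
qed

context
  fixes p :: "'a \<Rightarrow> 'a" and S :: "'a set"
  assumes p: "p permutes S" and S: "finite S"
begin

lemma cycles_cyclic: "C \<in> cycles p S \<Longrightarrow> cyclic_on p C"
  using cyclic_on_orbit[OF p S] by (auto simp: cycles_def)

lemma self_in_orbit: "x \<in> orbit p x"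
proof (rule permutation_self_in_orbit)
  show "permutation p" using p S by (auto simp: permutation_permutes)
qed

lemma Union_cycles: "\<Union>(cycles p S) = S"
proof
  show "\<Union>(cycles p S) \<subseteq> S" unfolding cycles_def using permutes_orbit_subset[OF p] by auto
  show "S \<subseteq> \<Union>(cycles p S)" unfolding cycles_def using self_in_orbit by auto
qed

lemma cycles_disjoint: "C \<in> cycles p S \<Longrightarrow> D \<in> cycles p S \<Longrightarrow> C \<noteq> D \<Longrightarrow> C \<inter> D = {}"
  using orbit_cyclic_eq3[OF cycles_cyclic, of C] orbit_cyclic_eq3[OF cycles_cyclic, of D]
  by (auto simp: disjoint_iff)

lemma finite_cycles: "finite (cycles p S)"
  using S by (simp add: cycles_def)

lemma finite_in_cycles: "C \<in> cycles p S \<Longrightarrow> finite C"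
  by (rule finite_cyclic_on[OF cycles_cyclic])

lemma orbit_in_cycles: "x \<in> S \<Longrightarrow> orbit p x \<in> cycles p S"
  by (simp add: cycles_def)

lemma in_cycles_eq_orbit: "C \<in> cycles p S \<Longrightarrow> x \<in> C \<Longrightarrow> C = orbit p x"
  using orbit_cyclic_eq3[OF cycles_cyclic] by simp

lemma card_eq_sum_cycles: "card S = (\<Sum>C\<in>cycles p S. card C)"
  using card_Union_disjoint[of "cycles p S"] Union_cycles cycles_disjoint finite_in_cycles
  by (auto simp: pairwise_def disjnt_def)

lemma cyclic_on_comp_transpose:
  assumes "C \<in> cycles p S" "a \<notin> C" "b \<notin> C"
  shows "cyclic_on (p \<circ> transpose a b) C"
proof -
  have "cyclic_on (p \<circ> transpose a b) C = cyclic_on p C"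
    using assms by (intro cyclic_cong) (auto simp: Transposition.transpose_def)
  then show ?thesis using cycles_cyclic assms by simp
qed

lemma cycles_merge:
  assumes "C \<in> cycles p S" "D \<in> cycles p S" "C \<noteq> D" "m \<in> C" "a \<in> D"
  shows "cycles (p \<circ> transpose a m) S = insert (C \<union> D) (cycles p S - {C, D})"
proof (rule cycles_eqI)
  fix E assume "E \<in> insert (C \<union> D) (cycles p S - {C, D})"
  then consider "E = C \<union> D" | "E \<in> cycles p S" "E \<noteq> C" "E \<noteq> D" by blast
  then show "cyclic_on (p \<circ> transpose a m) E"
  proof cases
    case 1
    then show ?thesis
      using cyclic_on_merge[OF cycles_cyclic[OF assms(1)] assms(4) cycles_cyclic[OF assms(2)] assms(5)]
        cycles_disjoint[OF assms(1-3)] by simp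
  next
    case 2
    then show ?thesis
      using cyclic_on_comp_transpose[of E a m] cycles_disjoint[OF _ assms(1), of E]
        cycles_disjoint[OF _ assms(2), of E] assms(4,5) by blast
  qed
next
  show "\<Union>(insert (C \<union> D) (cycles p S - {C, D})) = S"
    using Union_cycles assms(1,2) by auto
qed

text \<open>The non-membership facts let a product over the set of cycles break up into factors:
  \<open>A\<close> and \<open>B\<close> may have the same size, but they are distinct as
  sets.\<close>

lemma cycles_split:
  assumes "C \<in> cycles p S" "m \<in> C" and "0 < j" "j < card C"
  obtains A B where "cycles (p \<circ> transpose ((p ^^ j) m) m) S = insert A (insert B (cycles p S - {C}))"
    "A \<notin> insert B (cycles p S - {C})" "B \<notin> cycles p S - {C}" "card A = j" "card B = card C - j"
proof -
  define a where "a = (p ^^ j) m"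
  define A where "A = (\<lambda>i. (p ^^ Suc i) m) ` {..<j}"
  note s = cyclic_on_split[OF cycles_cyclic[OF assms(1)] assms(2-), folded A_def a_def]
  have fin: "finite C" using finite_in_cycles[OF assms(1)] .
  have aC: "a \<in> C" unfolding a_def using cyclic_on_funpow_in[OF cycles_cyclic[OF assms(1)] assms(2)] .
  have cB: "card (C - A) = card C - j" using s fin by (simp add: card_Diff_subset finite_subset)
  have ne: "A \<noteq> {}" "C - A \<noteq> {}" using s(4) cB assms(3,4) by (metis card.empty less_irrefl zero_less_diff)+
  have not_other: "X \<notin> cycles p S - {C}" if "X \<subseteq> C" "X \<noteq> {}" for X
    using cycles_disjoint[OF _ assms(1), of X] that by blast
  have "cycles (p \<circ> transpose a m) S = insert A (insert (C - A) (cycles p S - {C}))"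
  proof (rule cycles_eqI)
    fix E assume "E \<in> insert A (insert (C - A) (cycles p S - {C}))"
    then consider "E = A" | "E = C - A" | "E \<in> cycles p S" "E \<noteq> C" by blast
    then show "cyclic_on (p \<circ> transpose a m) E"
    proof cases
      case 3
      then show ?thesis
        using cyclic_on_comp_transpose[of E a m] cycles_disjoint[OF _ assms(1), of E] assms(2) aC by blast
    qed (use s in simp_all)
  next
    show "\<Union>(insert A (insert (C - A) (cycles p S - {C}))) = S"
      using Union_cycles assms(1) s(3) by auto
  qed
  moreover have "A \<notin> insert (C - A) (cycles p S - {C})"
    using not_other[OF s(3) ne(1)] ne by auto
  moreover have "C - A \<notin> cycles p S - {C}"
    by (rule not_other) (use ne in auto)
  ultimately show ?thesis
    using that[of A "C - A"] s(4) cB unfolding a_def by simp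
qed

lemma cycles_insert_fixpoint:
  assumes "n \<notin> S"
  shows "cycles p (insert n S) = insert {n} (cycles p S)"
proof -
  have "orbit p n = {n}"
    using p assms by (simp add: orbit_eq_singleton_iff permutes_def)
  then show ?thesis by (simp add: cycles_def)
qed

lemma singleton_notin_cycles: "n \<notin> S \<Longrightarrow> {n} \<notin> cycles p S"
  using Union_cycles by auto

end

text \<open>On \<open>insert n S\<close> the permutation \<open>p\<close> has the additional cycle
  \<open>{n}\<close>. The transposition merges it with the cycle of \<open>m\<close> and places
  \<open>n\<close> directly after \<open>m\<close>.\<close>

lemma cycles_insert:
  assumes p: "p permutes S" and S: "finite S" and "m \<in> S" "n \<notin> S"
  shows "cycles (p \<circ> transpose m n) (insert n S) =
    insert (insert n (orbit p m)) (cycles p S - {orbit p m})"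
    and "orbit (p \<circ> transpose m n) m = insert n (orbit p m)"
proof -
  let ?T = "insert n S"
  have pT: "p permutes ?T" and T: "finite ?T"
    using assms by (auto intro: permutes_subset)
  have cT: "cycles p ?T = insert {n} (cycles p S)"
    using cycles_insert_fixpoint[OF p S assms(4)] .
  have o: "orbit p m \<in> cycles p S" "m \<in> orbit p m"
    using orbit_in_cycles[OF p S] self_in_orbit[OF p S] assms by auto
  have ne: "orbit p m \<noteq> {n}" using o assms by auto
  have nn: "{n} \<notin> cycles p S" using singleton_notin_cycles[OF p S assms(4)] .
  have "cycles (p \<circ> transpose n m) ?T = insert (orbit p m \<union> {n}) (cycles p ?T - {orbit p m, {n}})"
    using cycles_merge[OF pT T, of "orbit p m" "{n}" m n] cT o ne by auto
  then show eq: "cycles (p \<circ> transpose m n) ?T = insert (insert n (orbit p m)) (cycles p S - {orbit p m})"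
    using cT nn by (auto simp: transpose_commute)
  have q: "p \<circ> transpose m n permutes ?T"
    using assms pT by (intro permutes_compose permutes_swap_id) auto
  show "orbit (p \<circ> transpose m n) m = insert n (orbit p m)"
    using in_cycles_eq_orbit[OF q T, of "insert n (orbit p m)" m] eq o by auto
qed

section \<open>The polynomials in Boccara's formula\<close>

text \<open>Naming x and x - 1 keeps them opaque, so that ring normalization works with two symbols;
  \<open>polyX_eq\<close> brings in their difference 1.\<close>

definition polyX :: "real poly" where "polyX = [:0, 1:]"
definition polyY :: "real poly" where "polyY = [:-1, 1:]"

definition hpoly :: "nat \<Rightarrow> real poly" where
  "hpoly l = polyX ^ l - polyY ^ l"

lemma polyX_eq: "polyX = polyY + 1"
  by (simp add: polyX_def polyY_def one_pCons)

lemma pderiv_polyX [simp]: "pderiv polyX = 1" and pderiv_polyY [simp]: "pderiv polyY = 1"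
  by (simp_all add: polyX_def polyY_def pderiv_pCons)

lemma poly_polyX [simp]: "poly polyX t = t" and poly_polyY [simp]: "poly polyY t = t - 1"
  by (simp_all add: polyX_def polyY_def)

lemma hpoly_0 [simp]: "hpoly 0 = 0" and hpoly_1 [simp]: "hpoly (Suc 0) = 1"
  by (simp_all add: hpoly_def polyX_eq)

lemma hpoly_Suc: "hpoly (Suc l) = polyY * hpoly l + polyX ^ l"
  by (simp add: hpoly_def polyX_eq algebra_simps)

text \<open>The addition law of the Lucas sequence with roots x and x - 1, whose difference is 1.\<close>

lemma hpoly_add:
  "hpoly (m + Suc k) = hpoly (Suc m) * hpoly (Suc k) - polyX * polyY * hpoly m * hpoly k"
proof -
  have "hpoly (Suc m) * hpoly (Suc k) - polyX * polyY * hpoly m * hpoly k =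
      (polyX - polyY) * (polyX * polyX ^ m * polyX ^ k) - (polyX - polyY) * (polyY * polyY ^ m * polyY ^ k)"
    by (simp add: hpoly_def algebra_simps)
  also have "polyX - polyY = 1" by (simp add: polyX_eq)
  finally show ?thesis by (simp add: hpoly_def power_add mult_ac)
qed

lemma pderiv_polyX_power: "pderiv (polyX ^ Suc k) = of_nat (Suc k) * polyX ^ k"
  and pderiv_polyY_power: "pderiv (polyY ^ Suc k) = of_nat (Suc k) * polyY ^ k"
  unfolding pderiv_power_Suc by (simp_all add: of_nat_poly)

lemma pderiv_hpoly: "pderiv (hpoly k) = of_nat k * hpoly (k - 1)"
proof (cases k)
  case (Suc j)
  then show ?thesis
    by (simp add: hpoly_def pderiv_diff pderiv_polyX_power pderiv_polyY_power right_diff_distrib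
        del: power_Suc of_nat_Suc)
qed simp

text \<open>A geometric sum whose denominator \<open>polyX - polyY\<close> is 1.\<close>

lemma sum_polyX_polyY: "(\<Sum>j=1..l. polyX ^ j * polyY ^ (Suc l - j)) = polyX * polyY * hpoly l"
proof (induction l)
  case (Suc l)
  have "(\<Sum>j=1..Suc l. polyX ^ j * polyY ^ (Suc (Suc l) - j)) =
      (\<Sum>j=1..l. polyX ^ j * polyY ^ (Suc (Suc l) - j)) + polyX ^ Suc l * polyY"
    by simp
  also have "(\<Sum>j=1..l. polyX ^ j * polyY ^ (Suc (Suc l) - j)) =
      (\<Sum>j=1..l. polyY * (polyX ^ j * polyY ^ (Suc l - j)))"
    by (rule sum.cong) (auto simp: Suc_diff_le)
  finally show ?case unfolding sum_distrib_left[symmetric] Suc.IH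
    by (simp add: hpoly_Suc algebra_simps)
qed simp

lemma sum_hpoly_mult:
  "(\<Sum>j=1..l. hpoly j * hpoly (Suc l - j)) =
    of_nat l * (polyX ^ Suc l + polyY ^ Suc l) - 2 * (polyX * polyY * hpoly l)"
proof -
  \<comment> \<open>The second cross term is written as the first one at the reflected index
    \<open>Suc l - j\<close>, so that reindexing identifies the two sums.\<close>
  have "hpoly j * hpoly (Suc l - j) = polyX ^ Suc l + polyY ^ Suc l
      - polyX ^ j * polyY ^ (Suc l - j) - polyX ^ (Suc l - j) * polyY ^ (Suc l - (Suc l - j))"
    if "j \<in> {1..l}" for j
  proof -
    have "Suc l = j + (Suc l - j)" "Suc l - (Suc l - j) = j" using that by auto
    then have "polyX ^ Suc l = polyX ^ j * polyX ^ (Suc l - j)"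
      "polyY ^ Suc l = polyY ^ j * polyY ^ (Suc l - j)" "Suc l - (Suc l - j) = j"
      by (metis power_add)+
    then show ?thesis unfolding hpoly_def by (simp only:) (simp add: algebra_simps del: power_Suc)
  qed
  then have "(\<Sum>j=1..l. hpoly j * hpoly (Suc l - j)) = (\<Sum>j=1..l. polyX ^ Suc l + polyY ^ Suc l
      - polyX ^ j * polyY ^ (Suc l - j) - polyX ^ (Suc l - j) * polyY ^ (Suc l - (Suc l - j)))"
    by (rule sum.cong[OF refl])
  also have "\<dots> = of_nat l * (polyX ^ Suc l + polyY ^ Suc l)
      - (\<Sum>j=1..l. polyX ^ j * polyY ^ (Suc l - j))
      - (\<Sum>j=1..l. polyX ^ (Suc l - j) * polyY ^ (Suc l - (Suc l - j)))"
    by (simp add: sum_subtractf del: power_Suc)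
  also have "(\<Sum>j=1..l. polyX ^ (Suc l - j) * polyY ^ (Suc l - (Suc l - j))) =
      (\<Sum>j=1..l. polyX ^ j * polyY ^ (Suc l - j))"
    by (rule sum.reindex_bij_witness[where i = "\<lambda>j. Suc l - j" and j = "\<lambda>j. Suc l - j"]) auto
  finally show ?thesis unfolding sum_polyX_polyY by simp
qed

text \<open>
  \<open>L\<close> stands for the length of the cycle into which a point is inserted and \<open>d D\<close> for the lengths of
  the other cycles; the two sums account for splitting and merging that cycle.
\<close>

lemma hpoly_cycle_identity:
  fixes d :: "'b \<Rightarrow> nat"
  assumes Q: "finite Q" and d: "\<And>D. D \<in> Q \<Longrightarrow> 0 < d D" and L: "0 < L"
  defines "R \<equiv> \<Prod>D\<in>Q. hpoly (d D)"
  shows "of_nat (L + (\<Sum>D\<in>Q. d D)) * (hpoly (Suc L) * R) =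
    (\<Sum>j\<in>{1..<L}. hpoly j * hpoly (L - j) * R)
    + (\<Sum>D\<in>Q. of_nat (d D) * (hpoly (L + d D) * (\<Prod>E\<in>Q - {D}. hpoly (d E))))
    + pderiv (polyX * polyY * hpoly L * R)"
proof -
  obtain l where l: "L = Suc l" using L gr0_implies_Suc by blast
  define RD where "RD D = (\<Prod>E\<in>Q - {D}. hpoly (d E))" for D
  have R: "R = hpoly (d D) * RD D" if "D \<in> Q" for D
    unfolding R_def RD_def using Q that by (rule prod.remove)
  define U where "U = (\<Sum>D\<in>Q. of_nat (d D) * (hpoly (d D - 1) * RD D))"
  have pR: "pderiv R = U"
    unfolding R_def U_def RD_def pderiv_prod by (rule sum.cong) (auto simp: pderiv_hpoly mult_ac)
  \<comment> \<open>The addition law is applied to each \<open>L + d D\<close>. Its correction term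
    contains \<open>of_nat (d D) * hpoly (d D - 1)\<close>, the derivative of
    \<open>hpoly (d D)\<close>; together the corrections form the part of the total derivative in
    which \<open>R\<close> is differentiated.\<close>
  have merge: "(\<Sum>D\<in>Q. of_nat (d D) * (hpoly (L + d D) * RD D)) =
      of_nat (\<Sum>D\<in>Q. d D) * (hpoly (Suc L) * R) - polyX * polyY * hpoly L * U"
  proof -
    have "of_nat (d D) * (hpoly (L + d D) * RD D) = of_nat (d D) * (hpoly (Suc L) * R)
        - polyX * polyY * hpoly L * (of_nat (d D) * (hpoly (d D - 1) * RD D))" if D: "D \<in> Q" for D
    proof -
      obtain e where e: "d D = Suc e" using d[OF D] gr0_implies_Suc by blast
      show ?thesis unfolding e hpoly_add R[OF D] by (simp add: algebra_simps)
    qed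
    then show ?thesis
      unfolding U_def of_nat_sum sum_distrib_left sum_distrib_right sum_subtractf[symmetric]
      by (rule sum.cong[OF refl])
  qed
  have "{1..<L} = {1..l}" using l by auto
  then have split: "(\<Sum>j\<in>{1..<L}. hpoly j * hpoly (L - j) * R) =
      (of_nat l * (polyX ^ Suc l + polyY ^ Suc l) - 2 * (polyX * polyY * hpoly l)) * R"
    unfolding l sum_distrib_right[symmetric] by (simp only: sum_hpoly_mult)
  have pd: "pderiv (polyX * polyY * hpoly L * R) = (polyX + polyY) * hpoly L * R
      + polyX * polyY * (of_nat (Suc l) * hpoly l) * R + polyX * polyY * hpoly L * U"
    unfolding pderiv_mult pR by (simp add: l pderiv_hpoly algebra_simps)
  \<comment> \<open>This is the Lucas recurrence, with the sum and the product of the roots as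
    coefficients. The next identity also uses that the roots differ by 1.\<close>
  have 1: "(polyX + polyY) * hpoly L = hpoly (Suc L) + polyX * polyY * hpoly l"
    unfolding l by (simp add: hpoly_def algebra_simps)
  have 2: "polyX ^ Suc l + polyY ^ Suc l + polyX * polyY * hpoly l = hpoly (Suc L)"
    unfolding l by (simp add: hpoly_def polyX_eq algebra_simps)
  have "(of_nat l * (polyX ^ Suc l + polyY ^ Suc l) - 2 * (polyX * polyY * hpoly l)) * R
      + ((polyX + polyY) * hpoly L * R + polyX * polyY * (of_nat (Suc l) * hpoly l) * R)
      = (of_nat l * (polyX ^ Suc l + polyY ^ Suc l + polyX * polyY * hpoly l) + hpoly (Suc L)) * R"
    unfolding 1 by (simp add: algebra_simps)
  also have "\<dots> = of_nat L * (hpoly (Suc L) * R)"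
    unfolding 2 by (simp add: l algebra_simps)
  finally have "(of_nat l * (polyX ^ Suc l + polyY ^ Suc l) - 2 * (polyX * polyY * hpoly l)) * R
      + ((polyX + polyY) * hpoly L * R + polyX * polyY * (of_nat (Suc l) * hpoly l) * R)
      = of_nat L * (hpoly (Suc L) * R)" .
  then show ?thesis
    unfolding merge[unfolded RD_def] split pd of_nat_add distrib_right by (simp add: algebra_simps)
qed

section \<open>Integrals over the unit interval and the closed form of the final sum\<close>

definition pint :: "real poly \<Rightarrow> real" where
  "pint q = integral {0..1} (poly q)"

lemma poly_has_integral_pint: "((\<lambda>t. poly q t) has_integral pint q) {0..1}"
  unfolding pint_def by (intro integrable_integral integrable_continuous_interval continuous_intros)

lemma pint_eqI: "((\<lambda>t. poly q t) has_integral c) {0..1} \<Longrightarrow> pint q = c"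
  unfolding pint_def by (rule integral_unique)

lemma pint_0 [simp]: "pint 0 = 0"
  by (rule pint_eqI) simp

lemma pint_add: "pint (q + r) = pint q + pint r"
  by (rule pint_eqI) (simp add: has_integral_add poly_has_integral_pint)

lemma pint_diff: "pint (q - r) = pint q - pint r"
  by (rule pint_eqI) (simp add: has_integral_diff poly_has_integral_pint)

lemma pint_of_nat: "pint (of_nat k * q) = of_nat k * pint q"
  by (rule pint_eqI) (simp add: of_nat_poly has_integral_mult_right poly_has_integral_pint)

lemma pint_sum: "pint (\<Sum>i\<in>A. f i) = (\<Sum>i\<in>A. pint (f i))"
  by (induction A rule: infinite_finite_induct) (simp_all add: pint_add)

lemma pint_pderiv: "pint (pderiv q) = poly q 1 - poly q 0"
proof (rule pint_eqI)
  show "((\<lambda>t. poly (pderiv q) t) has_integral (poly q 1 - poly q 0)) {0..1}"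
    by (rule fundamental_theorem_of_calculus)
      (auto intro!: has_field_derivative_at_within poly_DERIV
        simp: has_real_derivative_iff_has_vector_derivative[symmetric])
qed

text \<open>Integration by parts: \<open>polyX ^ Suc a * polyY ^ Suc b\<close> vanishes at 0 and 1,
  which trades a factor \<open>polyY\<close> for a factor \<open>polyX\<close>. The sign of this
  Beta integral appears because \<open>polyY\<close> is x - 1 and not 1 - x.\<close>

lemma pint_beta:
  "pint (polyX ^ a * polyY ^ b) = (- 1) ^ b * (fact a * fact b / fact (a + b + 1))"
proof (induction b arbitrary: a)
  case 0
  have "of_nat (Suc a) * pint (polyX ^ a) = 1"
    using pint_pderiv[of "polyX ^ Suc a"] unfolding pderiv_polyX_power pint_of_nat by simp
  then have "pint (polyX ^ a) = 1 / of_nat (Suc a)" by (simp add: field_simps)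
  then show ?case by simp
next
  case (Suc b)
  have "pderiv (polyX ^ Suc a * polyY ^ Suc b) =
      of_nat (Suc b) * (polyX ^ Suc a * polyY ^ b) + of_nat (Suc a) * (polyX ^ a * polyY ^ Suc b)"
    unfolding pderiv_mult pderiv_polyX_power pderiv_polyY_power by (simp only: mult_ac)
  then have "of_nat (Suc b) * pint (polyX ^ Suc a * polyY ^ b) + of_nat (Suc a) * pint (polyX ^ a * polyY ^ Suc b) = 0"
    using pint_pderiv[of "polyX ^ Suc a * polyY ^ Suc b"]
    by (simp add: pint_add pint_of_nat del: of_nat_Suc)
  then have "of_nat (Suc a) * pint (polyX ^ a * polyY ^ Suc b) =
      - (of_nat (Suc b) * ((- 1) ^ b * (fact (Suc a) * fact b / fact (Suc a + b + 1))))"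
    unfolding Suc.IH by linarith
  also have "\<dots> = of_nat (Suc a) * ((- 1) ^ Suc b * (fact a * fact (Suc b) / fact (a + Suc b + 1)))"
    by simp
  finally show ?case by (simp only: mult_cancel_left) (simp del: of_nat_Suc)
qed

text \<open>
  The conditions on \<open>a\<close>, \<open>b\<close>, \<open>c\<close> say that \<open>(x + 1) r(x + 1) + (N + 1 - x) r(x) = (x - 1)(x - 2)\<close>.
\<close>

lemma alternating_sum_telescope:
  fixes N :: nat and a b c :: real
  defines "r \<equiv> (\<lambda>x::real. a * x\<^sup>2 + b * x + c)"
  assumes a: "a * (N + 4) = 1" and b: "b * (N + 3) = - 3 - 3 * a" and c: "c * (N + 2) = 2 - a - b"
    and "M < N"
  shows "(\<Sum>l=1..M. (- 1) ^ l * ((real l - 1) * (real l - 2)) * (fact l * fact (N - l))) =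
    - (fact N * r 1) + (- 1) ^ M * (real N - real M) * r (real M + 1) * (fact (M + 1) * fact (N - (M + 1)))"
  using \<open>M < N\<close>
proof (induction M)
  case 0
  then show ?case by (simp add: fact_reduce)
next
  case (Suc M)
  then obtain K where K: "N = M + 2 + K" using less_imp_add_positive by (metis Suc_less_eq less_iff_Suc_add add_2_eq_Suc' add_Suc_right add_Suc)
  have key: "(x + 1) * r (x + 1) + (N + 1 - x) * r x = (x - 1) * (x - 2)" for x :: real
  proof -
    have "(x + 1) * r (x + 1) + (N + 1 - x) * r x =
        a * (N + 4) * x\<^sup>2 + (b * (N + 3) + 3 * a) * x + (c * (N + 2) + a + b)"
      by (simp add: r_def algebra_simps power2_eq_square)
    also have "\<dots> = (x - 1) * (x - 2)"
      unfolding a b c by (simp add: algebra_simps power2_eq_square)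
    finally show ?thesis .
  qed
  have f: "fact (N - Suc M) = (real N - real M - 1) * fact (N - (Suc M + 1))"
    "fact (Suc M + 1) = (real M + 2) * fact (Suc M)"
    unfolding K by (simp_all add: algebra_simps)
  have "(\<Sum>l=1..Suc M. (- 1) ^ l * ((real l - 1) * (real l - 2)) * (fact l * fact (N - l))) =
      - (fact N * r 1) + (- 1) ^ M * ((real N - real M) * r (real M + 1) - real M * (real M - 1))
        * (fact (Suc M) * fact (N - Suc M))"
    using Suc by (simp add: algebra_simps del: fact_Suc)
  also have "(real N - real M) * r (real M + 1) - real M * (real M - 1) =
      - ((real M + 2) * r (real M + 2))"
    using key[of "real M + 1"] by (simp add: algebra_simps)
  finally show ?case unfolding f by (simp add: algebra_simps del: fact_Suc)
qed

lemma two_times_choose_two: "2 * real (k choose 2) = real k * (real k - 1)"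
  by (induction k) (simp_all add: numeral_2_eq_2 algebra_simps)

text \<open>Up to sign, the subtracted term is the reciprocal of N + 1 times the binomial
  coefficient \<open>N choose l\<close>. It stays in factorials, the form in which the sum
  telescopes.\<close>

lemma pint_hpoly_polyX:
  assumes "l \<le> N"
  shows "pint (hpoly l * polyX ^ (N - l)) =
    1 / (real N + 1) - (- 1) ^ l * (fact l * fact (N - l)) / fact (N + 1)"
proof -
  have "hpoly l * polyX ^ (N - l) = polyX ^ (l + (N - l)) * polyY ^ 0 - polyX ^ (N - l) * polyY ^ l"
    unfolding hpoly_def power_add by (simp add: algebra_simps)
  also have "pint \<dots> = 1 / (real N + 1) - (- 1) ^ l * (fact l * fact (N - l)) / fact (N + 1)"
    using assms unfolding pint_diff pint_beta by (simp add: mult_ac)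
  finally show ?thesis .
qed

lemma sum_falling_two: "(\<Sum>l=1..N. (real l - 1) * (real l - 2)) = real N * (real N - 1) * (real N - 2) / 3"
  by (induction N) (simp_all add: field_simps)

text \<open>Telescoping works strictly below \<open>N\<close>. It is applied up to
  \<open>N - 1\<close>, where the boundary factor \<open>real N - real M\<close> is 1, and the
  summand for \<open>l = N\<close> is added separately.\<close>

lemma alternating_sum_value:
  assumes "1 \<le> N"
  shows "(\<Sum>l=1..N. (- 1) ^ l * ((real l - 1) * (real l - 2)) * (fact l * fact (N - l))) =
    fact N * ((- 1) ^ N * ((real N - 1) * (real N - 2)
      - (real N ^ 4 + 2 * real N ^ 3 - 13 * real N ^ 2 - 14 * real N + 36) / ((real N + 2) * (real N + 3) * (real N + 4)))
      - 12 / ((real N + 2) * (real N + 3) * (real N + 4)))"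
proof -
  define x where "x = real N"
  define D where "D = (x + 2) * (x + 3) * (x + 4)"
  have x: "x + 2 > 0" "x + 3 > 0" "x + 4 > 0" by (simp_all add: x_def)
  then have D: "D > 0" by (simp add: D_def)
  \<comment> \<open>The triangular system for the coefficients of the quadratic, solved over the
    common denominator \<open>D\<close>. Only its values at 1 and at \<open>x\<close> survive, see
    \<open>one\<close> and \<open>last\<close>.\<close>
  define a b c where "a = (x + 2) * (x + 3) / D" and "b = - 3 * (x + 5) * (x + 2) / D"
    and "c = (2 * x ^ 2 + 16 * x + 36) / D"
  obtain M where M: "N = Suc M" using assms by (metis One_nat_def Suc_le_D)
  have "a * (N + 4) = D / D" unfolding a_def D_def by (simp add: x_def)
  then have a: "a * (N + 4) = 1" using D by simp
  have "b * (N + 3) = (- 3 * D - 3 * ((x + 2) * (x + 3))) / D"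
    unfolding b_def D_def by (simp add: x_def algebra_simps)
  also have "\<dots> = - 3 - 3 * a" using D unfolding a_def by (simp add: diff_divide_distrib)
  finally have b: "b * (N + 3) = - 3 - 3 * a" .
  have "c * (N + 2) = (2 * D - (x + 2) * (x + 3) - (- 3 * (x + 5) * (x + 2))) / D"
    unfolding c_def D_def by (simp add: x_def algebra_simps power2_eq_square)
  also have "\<dots> = 2 - a - b" using D unfolding a_def b_def by (simp add: diff_divide_distrib)
  finally have c: "c * (N + 2) = 2 - a - b" .
  have one: "a * 1\<^sup>2 + b * 1 + c = 12 / D"
    unfolding a_def b_def c_def add_divide_distrib[symmetric] times_divide_eq_left
    by (simp add: algebra_simps power2_eq_square)
  have last: "a * x\<^sup>2 + b * x + c = (x ^ 4 + 2 * x ^ 3 - 13 * x ^ 2 - 14 * x + 36) / D"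
    unfolding a_def b_def c_def add_divide_distrib[symmetric] times_divide_eq_left
    by (simp add: algebra_simps power2_eq_square power3_eq_cube power4_eq_xxxx)
  have "(\<Sum>l=1..M. (- 1) ^ l * ((real l - 1) * (real l - 2)) * (fact l * fact (N - l))) =
      - (fact N * (12 / D)) + (- 1) ^ M * ((x ^ 4 + 2 * x ^ 3 - 13 * x ^ 2 - 14 * x + 36) / D) * fact N"
    using alternating_sum_telescope[OF a b c, of M] unfolding one last[symmetric]
    by (simp add: M x_def algebra_simps del: fact_Suc)
  moreover have "(\<Sum>l=1..N. (- 1) ^ l * ((real l - 1) * (real l - 2)) * (fact l * fact (N - l))) =
      (\<Sum>l=1..M. (- 1) ^ l * ((real l - 1) * (real l - 2)) * (fact l * fact (N - l)))
      - (- 1) ^ M * ((x - 1) * (x - 2)) * fact N"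
    by (simp add: M x_def del: fact_Suc)
  moreover have "(- 1 :: real) ^ N = - ((- 1) ^ M)" by (simp add: M)
  moreover have "- (f * g) + m * e * f - m * y * f = f * (- m * (y - e) - g)" for f g m e y :: real
    by (simp add: algebra_simps)
  ultimately show ?thesis unfolding x_def[symmetric] D_def[symmetric] by presburger
qed

text \<open>This will be the probability for \<open>N + 1\<close> points, so even \<open>N\<close>
  belongs to the odd case of the theorem. The factor 2 turns the binomial coefficients into the
  products (l - 1)(l - 2) of the alternating sum.\<close>

lemma pint_marked_cycle_sum:
  assumes "2 \<le> N"
  shows "2 * pint ((\<Sum>l=1..N. of_nat ((l - 1) choose 2) * (hpoly l * polyX ^ (N - l)))
      + of_nat (N choose 2) * hpoly (Suc N)) / (real N * (real N - 1)) =
    (if even N then 1 / 3 + 1 / ((real N - 1) * (real N + 4))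
     else 1 / 3 - 3 / (real N * (real N + 3)))"
proof -
  define x where "x = real N"
  have x: "x \<ge> 2" using assms by (simp add: x_def)
  define s where "s = (- 1 :: real) ^ N"
  have "2 * pint (\<Sum>l=1..N. of_nat ((l - 1) choose 2) * (hpoly l * polyX ^ (N - l))) =
      (\<Sum>l=1..N. 2 * real ((l - 1) choose 2) *
        (1 / (real N + 1) - (- 1) ^ l * (fact l * fact (N - l)) / fact (N + 1)))"
    unfolding pint_sum pint_of_nat sum_distrib_left
    by (rule sum.cong) (auto simp: pint_hpoly_polyX)
  also have "\<dots> = (\<Sum>l=1..N. (real l - 1) * (real l - 2) / (real N + 1)
      - (- 1) ^ l * ((real l - 1) * (real l - 2)) * (fact l * fact (N - l)) / fact (N + 1))"
  proof (rule sum.cong)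
    fix l assume l: "l \<in> {1..N}"
    have "2 * real ((l - 1) choose 2) = (real l - 1) * (real l - 2)"
      using l by (simp add: two_times_choose_two of_nat_diff)
    moreover have "q * (1 / a - e * b / d) = q / a - e * q * b / d" for q a e b d :: real
      by (simp add: right_diff_distrib)
    ultimately show "2 * real ((l - 1) choose 2) *
        (1 / (real N + 1) - (- 1) ^ l * (fact l * fact (N - l)) / fact (N + 1)) =
      (real l - 1) * (real l - 2) / (real N + 1)
      - (- 1) ^ l * ((real l - 1) * (real l - 2)) * (fact l * fact (N - l)) / fact (N + 1)"
      by presburger
  qed simp
  also have "\<dots> = x * (x - 1) * (x - 2) / 3 / (x + 1) -
      (s * ((x - 1) * (x - 2) - (x ^ 4 + 2 * x ^ 3 - 13 * x ^ 2 - 14 * x + 36) / ((x + 2) * (x + 3) * (x + 4)))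
      - 12 / ((x + 2) * (x + 3) * (x + 4))) / (x + 1)"
    unfolding sum_subtractf sum_divide_distrib[symmetric] sum_falling_two
    using assms by (subst alternating_sum_value) (simp_all add: x_def s_def add.commute)
  finally have S: "2 * pint (\<Sum>l=1..N. of_nat ((l - 1) choose 2) * (hpoly l * polyX ^ (N - l))) = \<dots>" .
  \<comment> \<open>The term of the cycle through all points is homogeneous of degree
    \<open>N + 1\<close> in \<open>polyX\<close> and \<open>polyY\<close>, while the others have
    degree \<open>N\<close>. Its integral vanishes for odd \<open>N\<close>.\<close>
  have "pint (hpoly (Suc N)) = (1 + s) / (x + 2)"
    using pint_hpoly_polyX[of "Suc N" "Suc N"] by (simp add: x_def s_def add_divide_distrib add.commute)
  then have "2 * pint (of_nat (N choose 2) * hpoly (Suc N)) = x * (x - 1) * ((1 + s) / (x + 2))"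
    unfolding pint_of_nat x_def by (simp only: mult.assoc[symmetric] two_times_choose_two)
  then have *: "2 * pint ((\<Sum>l=1..N. of_nat ((l - 1) choose 2) * (hpoly l * polyX ^ (N - l)))
      + of_nat (N choose 2) * hpoly (Suc N)) = x * (x - 1) * (x - 2) / 3 / (x + 1) -
      (s * ((x - 1) * (x - 2) - (x ^ 4 + 2 * x ^ 3 - 13 * x ^ 2 - 14 * x + 36) / ((x + 2) * (x + 3) * (x + 4)))
      - 12 / ((x + 2) * (x + 3) * (x + 4))) / (x + 1) + x * (x - 1) * ((1 + s) / (x + 2))"
    unfolding pint_add distrib_left S by simp
  have nz: "x \<noteq> 0" "x - 1 \<noteq> 0" "x + 1 \<noteq> 0" "x + 2 \<noteq> 0" "x + 3 \<noteq> 0" "x + 4 \<noteq> 0" using x by auto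
  show ?thesis
  proof (cases "even N")
    case True
    then have s: "s = 1" by (simp add: s_def)
    have "(x * (x - 1) * (x - 2) / 3 / (x + 1) -
      (1 * ((x - 1) * (x - 2) - (x ^ 4 + 2 * x ^ 3 - 13 * x ^ 2 - 14 * x + 36) / ((x + 2) * (x + 3) * (x + 4)))
      - 12 / ((x + 2) * (x + 3) * (x + 4))) / (x + 1) + x * (x - 1) * ((1 + 1) / (x + 2))) / (x * (x - 1))
      = 1 / 3 + 1 / ((x - 1) * (x + 4))"
      using nz by (simp add: divide_simps) algebra
    then show ?thesis
      unfolding * x_def[symmetric] s using True by simp
  next
    case False
    then have s: "s = - 1" by (simp add: s_def)
    have "(x * (x - 1) * (x - 2) / 3 / (x + 1) -
      ((- 1) * ((x - 1) * (x - 2) - (x ^ 4 + 2 * x ^ 3 - 13 * x ^ 2 - 14 * x + 36) / ((x + 2) * (x + 3) * (x + 4)))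
      - 12 / ((x + 2) * (x + 3) * (x + 4))) / (x + 1) + x * (x - 1) * ((1 + (- 1)) / (x + 2))) / (x * (x - 1))
      = 1 / 3 - 3 / (x * (x + 3))"
      using nz by (simp add: divide_simps) algebra
    then show ?thesis
      unfolding * x_def[symmetric] s using False by simp
  qed
qed

section \<open>Boccara's formula\<close>

definition cycle_weight :: "('a \<Rightarrow> 'a) \<Rightarrow> 'a set \<Rightarrow> real poly" where
  "cycle_weight p S = (\<Prod>C\<in>cycles p S. hpoly (card C))"

text \<open>By \<open>cycle_weight_insert\<close> the right side is \<open>card S\<close> times the
  integral for the permutation with a new point inserted after \<open>m\<close>. Thus the integrals
  obey the recursion found for factorizations in
  \<open>num_factorizations_comp_transpose\<close>.\<close>

lemma pint_cycle_weight_transpositions: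
  assumes p: "p permutes S" and S: "finite S" and m: "m \<in> S"
  shows "(\<Sum>a\<in>S - {m}. pint (cycle_weight (p \<circ> transpose a m) S)) =
    real (card S) * pint (hpoly (Suc (card (orbit p m))) *
      (\<Prod>C\<in>cycles p S - {orbit p m}. hpoly (card C)))"
proof -
  define C where "C = orbit p m"
  define Q where "Q = cycles p S - {C}"
  define L where "L = card C"
  define R where "R = (\<Prod>D\<in>Q. hpoly (card D))"
  have C: "C \<in> cycles p S" "m \<in> C"
    using orbit_in_cycles[OF p S m] self_in_orbit[OF p S] by (auto simp: C_def)
  have cyc: "cycles p S = insert C Q" "C \<notin> Q" using C by (auto simp: Q_def)
  have finQ: "finite Q" using finite_cycles[OF p S] by (simp add: Q_def)
  have cC: "cyclic_on p C" using cycles_cyclic[OF p S C(1)] .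
  note enum = cyclic_on_enum[OF cC C(2), folded L_def]
  have disj: "D \<inter> E = {}" if "D \<in> cycles p S" "E \<in> cycles p S" "D \<noteq> E" for D E
    using cycles_disjoint[OF p S that] .
  have finD: "finite D" if "D \<in> cycles p S" for D using finite_in_cycles[OF p S that] .
  have ne: "D \<noteq> {}" if "D \<in> cycles p S" for D
    using cycles_cyclic[OF p S that] by (auto simp: cyclic_on_def)
  have split: "cycle_weight (p \<circ> transpose ((p ^^ j) m) m) S = hpoly j * hpoly (L - j) * R"
    if j: "j \<in> {1..<L}" for j
  proof -
    obtain A B where AB: "cycles (p \<circ> transpose ((p ^^ j) m) m) S = insert A (insert B Q)"
      "A \<notin> insert B Q" "B \<notin> Q" "card A = j" "card B = L - j"
      using cycles_split[OF p S C, of j] j unfolding Q_def L_def by auto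
    show ?thesis unfolding cycle_weight_def AB(1) R_def using AB(2-) finQ by (simp add: mult.assoc)
  qed
  have merge: "cycle_weight (p \<circ> transpose a m) S = hpoly (L + card D) * (\<Prod>E\<in>Q - {D}. hpoly (card E))"
    if D: "D \<in> Q" and a: "a \<in> D" for D a
  proof -
    have D': "D \<in> cycles p S" "C \<noteq> D" using D by (auto simp: Q_def)
    have eq: "cycles (p \<circ> transpose a m) S = insert (C \<union> D) (Q - {D})"
      using cycles_merge[OF p S C(1) D' C(2) a] unfolding Q_def by auto
    have "C \<union> D \<notin> Q - {D}"
    proof
      assume "C \<union> D \<in> Q - {D}"
      then have "C \<union> D \<in> cycles p S" "C \<union> D \<noteq> C" by (auto simp: Q_def)
      then show False using disj[OF _ C(1)] C(2) by blast
    qed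
    moreover have "card (C \<union> D) = L + card D"
      unfolding L_def using disj[OF C(1) D'] finD C(1) D' by (intro card_Un_disjoint) auto
    ultimately show ?thesis unfolding cycle_weight_def eq using finQ by simp
  qed
  have "(\<lambda>j. (p ^^ j) m) ` {1..<L} = C - {m}" and inj: "inj_on (\<lambda>j. (p ^^ j) m) {1..<L}"
  proof -
    have L: "{1..<L} = {..<L} - {0}" by auto
    show "inj_on (\<lambda>j. (p ^^ j) m) {1..<L}" unfolding L using enum(2) by (rule inj_on_diff)
    have "(\<lambda>j. (p ^^ j) m) ` ({..<L} - {0}) = (\<lambda>j. (p ^^ j) m) ` {..<L} - (\<lambda>j. (p ^^ j) m) ` {0}"
      using enum(2,4) by (intro inj_on_image_set_diff) auto
    then show "(\<lambda>j. (p ^^ j) m) ` {1..<L} = C - {m}" unfolding L enum(3) by simp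
  qed
  then have sumC: "(\<Sum>a\<in>C - {m}. pint (cycle_weight (p \<circ> transpose a m) S)) =
      (\<Sum>j\<in>{1..<L}. pint (hpoly j * hpoly (L - j) * R))"
    by (intro sum.reindex_cong[OF inj]) (simp_all only: split)
  have Sm: "S - {m} = (C - {m}) \<union> \<Union>Q"
  proof -
    have "S = C \<union> \<Union>Q" using Union_cycles[OF p S] cyc(1) by simp
    moreover have "m \<notin> \<Union>Q" using disj[OF C(1)] C(2) unfolding Q_def by blast
    ultimately show ?thesis by blast
  qed
  have "(\<Sum>a\<in>S - {m}. pint (cycle_weight (p \<circ> transpose a m) S)) =
      (\<Sum>a\<in>C - {m}. pint (cycle_weight (p \<circ> transpose a m) S)) +
      (\<Sum>a\<in>\<Union>Q. pint (cycle_weight (p \<circ> transpose a m) S))"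
    unfolding Sm
  proof (rule sum.union_disjoint)
    show "finite (C - {m})" "finite (\<Union>Q)" using finD C(1) finQ by (auto simp: Q_def)
    show "(C - {m}) \<inter> \<Union>Q = {}" using disj[OF C(1)] unfolding Q_def by blast
  qed
  also have "(\<Sum>a\<in>\<Union>Q. pint (cycle_weight (p \<circ> transpose a m) S)) =
      (\<Sum>D\<in>Q. \<Sum>a\<in>D. pint (cycle_weight (p \<circ> transpose a m) S))"
  proof -
    have "\<forall>A\<in>Q. finite A" "\<forall>A\<in>Q. \<forall>B\<in>Q. A \<noteq> B \<longrightarrow> A \<inter> B = {}"
      using finD disj by (simp_all add: Q_def)
    then show ?thesis by (simp add: sum.Union_disjoint)
  qed
  \<comment> \<open>All points of \<open>D\<close> lead to the same merged cycle, which gives the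
    factor \<open>card D\<close>.\<close>
  also have "\<dots> = (\<Sum>D\<in>Q. pint (of_nat (card D) * (hpoly (L + card D) * (\<Prod>E\<in>Q - {D}. hpoly (card E)))))"
    by (rule sum.cong) (simp_all add: merge pint_of_nat)
  finally have sum: "(\<Sum>a\<in>S - {m}. pint (cycle_weight (p \<circ> transpose a m) S)) =
      pint ((\<Sum>j\<in>{1..<L}. hpoly j * hpoly (L - j) * R)
        + (\<Sum>D\<in>Q. of_nat (card D) * (hpoly (L + card D) * (\<Prod>E\<in>Q - {D}. hpoly (card E)))))"
    unfolding sumC by (simp only: pint_add pint_sum)
  have "card S = L + (\<Sum>D\<in>Q. card D)"
    unfolding card_eq_sum_cycles[OF p S] cyc(1) L_def using cyc(2) finQ by simp
  moreover have "0 < card D" if "D \<in> Q" for D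
    using that ne finD by (auto simp: Q_def card_gt_0_iff)
  ultimately have "of_nat (card S) * (hpoly (Suc L) * R) =
      ((\<Sum>j\<in>{1..<L}. hpoly j * hpoly (L - j) * R)
        + (\<Sum>D\<in>Q. of_nat (card D) * (hpoly (L + card D) * (\<Prod>E\<in>Q - {D}. hpoly (card E)))))
      + pderiv (polyX * polyY * hpoly L * R)"
    unfolding R_def using hpoly_cycle_identity[OF finQ, of card L] enum(4) by simp
  then have "real (card S) * pint (hpoly (Suc L) * R) =
      (\<Sum>a\<in>S - {m}. pint (cycle_weight (p \<circ> transpose a m) S)) + pint (pderiv (polyX * polyY * hpoly L * R))"
    unfolding sum by (metis pint_add pint_of_nat)
  moreover have "pint (pderiv (polyX * polyY * hpoly L * R)) = 0"
    unfolding pint_pderiv by simp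
  ultimately show ?thesis by (simp add: R_def L_def Q_def C_def)
qed

section \<open>Cycles through all points of a finite set and products of two of them\<close>

definition long_cycles :: "'a set \<Rightarrow> ('a \<Rightarrow> 'a) set" where
  "long_cycles S = {p. p permutes S \<and> cyclic_on p S}"

lemma finite_long_cycles: "finite S \<Longrightarrow> finite (long_cycles S)"
  unfolding long_cycles_def by (rule finite_subset[OF _ finite_permutations]) auto

lemma transpose_comp_permutes:
  assumes "u permutes S" "n \<notin> S"
  shows "transpose (u a) n \<circ> u = u \<circ> transpose a n"
proof -
  have "inv u (u a) = a" using assms(1) by (simp add: permutes_inverses)
  moreover have "inv u n = n" using permutes_inv[OF assms(1)] assms(2) by (rule permutes_not_in)
  ultimately show ?thesis using transpose_comp_eq[OF permutes_bij[OF assms(1)], of "u a" n] by simp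
qed

lemma comp_transpose_cancel: "p \<circ> transpose a b \<circ> transpose a b = p"
  by (simp add: comp_assoc)

lemma permutes_insert_comp:
  assumes "u permutes S" "a \<in> S"
  shows "u \<circ> transpose a n permutes insert n S"
  using assms permutes_subset[OF assms(1), of "insert n S"]
  by (intro permutes_compose permutes_swap_id) auto

lemma permutes_insert_removal:
  assumes "q permutes insert n S" "n \<notin> S" "q a = n"
  shows "q \<circ> transpose a n permutes S"
proof (rule permutes_superset)
  have "a \<in> insert n S" using assms(1,3) by (metis insertI1 permutes_in_image)
  then show "q \<circ> transpose a n permutes insert n S"
    using assms(1) by (intro permutes_compose permutes_swap_id) auto
  show "(q \<circ> transpose a n) x = x" if "x \<in> insert n S - S" for x
    using that assms(3) by auto
qed

text \<open>In \<open>u \<circ> transpose a n\<close> the point \<open>n\<close> stands directly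
  after \<open>a\<close>, in \<open>transpose b n \<circ> u\<close> directly before
  \<open>b\<close>. Both forms are needed, because the transpositions have to sit at the outer ends
  of a product of two cycles.\<close>

lemma long_cycles_insert:
  assumes S: "finite S" "S \<noteq> {}" "n \<notin> S"
  shows "bij_betw (\<lambda>(a, u). u \<circ> transpose a n) (S \<times> long_cycles S) (long_cycles (insert n S))"
    and "bij_betw (\<lambda>(b, u). transpose b n \<circ> u) (S \<times> long_cycles S) (long_cycles (insert n S))"
proof -
  let ?r = "\<lambda>(a, u). u \<circ> transpose a n" and ?l = "\<lambda>(b, u). transpose b n \<circ> u"
  have fix_n: "u n = n" if "u \<in> long_cycles S" for u
    using that S by (auto simp: long_cycles_def permutes_not_in)
  have inS: "u a \<in> S" if "u \<in> long_cycles S" "a \<in> S" for u a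
    using that by (auto simp: long_cycles_def permutes_in_image)
  have into: "u \<circ> transpose a n \<in> long_cycles (insert n S)"
    if u: "u \<in> long_cycles S" and a: "a \<in> S" for u a
  proof -
    have "orbit u n = {n}" using fix_n[OF u] by (simp add: orbit_eq_singleton_iff)
    then have "cyclic_on u {n}" by (simp add: cyclic_on_def)
    then have "cyclic_on (u \<circ> transpose n a) (S \<union> {n})"
      using u a S by (intro cyclic_on_merge) (auto simp: long_cycles_def)
    then show ?thesis
      using u permutes_insert_comp[of u S a n] a
      by (simp add: long_cycles_def transpose_commute[of n a])
  qed
  have onto: "\<exists>a\<in>S. \<exists>u\<in>long_cycles S. q = u \<circ> transpose a n"
    if q: "q \<in> long_cycles (insert n S)" for q
  proof -
    let ?T = "insert n S"
    have qp: "q permutes ?T" and qc: "cyclic_on q ?T" using q by (auto simp: long_cycles_def)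
    have cT: "card ?T = Suc (card S)" "0 < card S" using S by (auto simp: card_gt_0_iff)
    \<comment> \<open>One step short of a full turn, this is the predecessor of \<open>n\<close>;
      splitting there cuts off \<open>n\<close> as a fixed point.\<close>
    define a where "a = (q ^^ card S) n"
    have qa: "q a = n"
      using cyclic_on_enum(1)[OF qc, of n] cT by (simp add: a_def)
    define A where "A = (\<lambda>i. (q ^^ Suc i) n) ` {..<card S}"
    have "n \<in> ?T" "card S < card ?T" using cT by auto
    note s = cyclic_on_split[OF qc this(1) cT(2) this(2), folded A_def a_def]
    have "A = S"
    proof -
      have inj: "inj_on (\<lambda>i. (q ^^ i) n) {..<card ?T}" using cyclic_on_enum(2)[OF qc, of n] by simp
      have ne: "(q ^^ Suc i) n \<noteq> n" if "i < card S" for i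
        using inj_onD[OF inj, of "Suc i" 0] that cT by auto
      have "n \<notin> A"
      proof
        assume "n \<in> A"
        then obtain i where "i < card S" "(q ^^ Suc i) n = n" unfolding A_def by force
        then show False using ne by blast
      qed
      then have "A \<subseteq> S" using s(3) by auto
      then show ?thesis using s(4) card_subset_eq[OF S(1)] by blast
    qed
    then have "cyclic_on (q \<circ> transpose a n) S" using s(1) by simp
    moreover have "q \<circ> transpose a n permutes S"
      using permutes_insert_removal[OF qp S(3) qa] .
    moreover have "a \<noteq> n"
    proof
      assume "a = n"
      then have "orbit q n = {n}" using qa by (simp add: orbit_eq_singleton_iff)
      then show False using orbit_cyclic_eq3[OF qc, of n] S by auto
    qed
    moreover have "a \<in> ?T" using qa qp by (metis insertI1 permutes_in_image)
    ultimately show ?thesis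
      by (intro bexI[of _ a] bexI[of _ "q \<circ> transpose a n"])
        (auto simp: comp_transpose_cancel long_cycles_def)
  qed
  show "bij_betw ?r (S \<times> long_cycles S) (long_cycles (insert n S))"
  proof (rule bij_betw_imageI)
    show "inj_on ?r (S \<times> long_cycles S)"
    proof (rule inj_onI, clarify)
      fix a u b v
      assume u: "u \<in> long_cycles S" and v: "v \<in> long_cycles S" and a: "a \<in> S" "b \<in> S"
        and eq: "u \<circ> transpose a n = v \<circ> transpose b n"
      have "(u \<circ> transpose a n) a = n" "(v \<circ> transpose b n) b = n" using fix_n u v by auto
      moreover have "inj (u \<circ> transpose a n)"
        using into[OF u a(1)] permutes_inj unfolding long_cycles_def by blast
      ultimately have "a = b" using eq by (metis injD)
      then show "a = b \<and> u = v" using eq comp_transpose_cancel by metis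
    qed
    show "?r ` (S \<times> long_cycles S) = long_cycles (insert n S)"
    proof (intro equalityI subsetI)
      fix q assume "q \<in> ?r ` (S \<times> long_cycles S)"
      then show "q \<in> long_cycles (insert n S)" using into by auto
    next
      fix q assume "q \<in> long_cycles (insert n S)"
      then obtain a u where "a \<in> S" "u \<in> long_cycles S" "q = u \<circ> transpose a n" using onto by blast
      then show "q \<in> ?r ` (S \<times> long_cycles S)" by (intro image_eqI[of _ _ "(a, u)"]) auto
    qed
  qed
  have comm: "transpose (u a) n \<circ> u = u \<circ> transpose a n" if "u \<in> long_cycles S" for u a
    using that S transpose_comp_permutes[of u S n a] by (simp add: long_cycles_def)
  show "bij_betw ?l (S \<times> long_cycles S) (long_cycles (insert n S))"
  proof (rule bij_betw_imageI)
    show "inj_on ?l (S \<times> long_cycles S)"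
    proof (rule inj_onI, clarify)
      fix a u b v
      assume u: "u \<in> long_cycles S" and v: "v \<in> long_cycles S" and a: "a \<in> S" "b \<in> S"
        and eq: "transpose a n \<circ> u = transpose b n \<circ> v"
      have "(transpose a n \<circ> u) n = a" "(transpose b n \<circ> v) n = b" using fix_n[OF u] fix_n[OF v] by simp_all
      then have ab: "a = b" using eq by simp
      then have "transpose a n \<circ> (transpose a n \<circ> u) = transpose a n \<circ> (transpose a n \<circ> v)"
        using eq by simp
      then show "a = b \<and> u = v" using ab by (simp add: comp_assoc[symmetric])
    qed
    show "?l ` (S \<times> long_cycles S) = long_cycles (insert n S)"
    proof (intro equalityI subsetI)
      fix q assume "q \<in> ?l ` (S \<times> long_cycles S)"
      then obtain b u where bu: "b \<in> S" "u \<in> long_cycles S" "q = transpose b n \<circ> u" by auto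
      then have "u ` S = S" by (simp add: long_cycles_def permutes_image)
      then obtain a where "a \<in> S" "b = u a" using bu(1) by blast
      then show "q \<in> long_cycles (insert n S)" using bu comm into by simp
    next
      fix q assume "q \<in> long_cycles (insert n S)"
      then obtain a u where "a \<in> S" "u \<in> long_cycles S" "q = u \<circ> transpose a n" using onto by blast
      then have "q = ?l (u a, u)" "(u a, u) \<in> S \<times> long_cycles S" using comm inS by auto
      then show "q \<in> ?l ` (S \<times> long_cycles S)" by (rule image_eqI)
    qed
  qed
qed

lemma long_cycles_singleton: "long_cycles {x} = {id}"
proof -
  have "orbit id x = {x}" by (simp add: orbit_eq_singleton_iff)
  then have "cyclic_on id {x}" by (simp add: cyclic_on_def)
  then show ?thesis by (auto simp: long_cycles_def)
qed

lemma card_long_cycles: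
  assumes "finite S" "S \<noteq> {}"
  shows "card (long_cycles S) = fact (card S - 1)"
  using assms
proof (induction rule: finite_ne_induct)
  case (singleton x)
  then show ?case by (simp add: long_cycles_singleton)
next
  case (insert n S)
  have "card (long_cycles (insert n S)) = card S * fact (card S - 1)"
    using bij_betw_same_card[OF long_cycles_insert(1)[of S n]] insert by (simp add: card_cartesian_product)
  then show ?case using insert by (simp add: fact_reduce card_gt_0_iff)
qed

definition num_factorizations :: "'a set \<Rightarrow> ('a \<Rightarrow> 'a) \<Rightarrow> nat" where
  "num_factorizations S w = (\<Sum>u\<in>long_cycles S. \<Sum>v\<in>long_cycles S. of_bool (u \<circ> v = w))"

lemma num_factorizations_eq_0:
  assumes "\<not> w permutes S"
  shows "num_factorizations S w = 0"
proof -
  have "u \<circ> v \<noteq> w" if "u \<in> long_cycles S" "v \<in> long_cycles S" for u v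
    using assms that permutes_compose unfolding long_cycles_def by blast
  then show ?thesis unfolding num_factorizations_def by simp
qed

lemma num_factorizations_insert:
  assumes S: "finite S" "S \<noteq> {}" "n \<notin> S" and w: "w permutes insert n S"
  shows "num_factorizations (insert n S) w =
    (\<Sum>a\<in>{a \<in> S. w a \<noteq> n}. num_factorizations S (transpose (w a) n \<circ> w \<circ> transpose a n))"
proof -
  let ?K = "\<lambda>b a. transpose b n \<circ> w \<circ> transpose a n"
  have eq: "(transpose b n \<circ> u) \<circ> (v \<circ> transpose a n) = w \<longleftrightarrow> u \<circ> v = ?K b a" for a b u v
  proof
    assume "(transpose b n \<circ> u) \<circ> (v \<circ> transpose a n) = w"
    then have "?K b a = transpose b n \<circ> ((transpose b n \<circ> u) \<circ> (v \<circ> transpose a n)) \<circ> transpose a n" by simp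
    then show "u \<circ> v = ?K b a" by (simp add: fun_eq_iff)
  next
    assume "u \<circ> v = ?K b a"
    then have "transpose b n \<circ> (u \<circ> v) \<circ> transpose a n = transpose b n \<circ> ?K b a \<circ> transpose a n" by simp
    then show "(transpose b n \<circ> u) \<circ> (v \<circ> transpose a n) = w" by (simp add: fun_eq_iff)
  qed
  \<comment> \<open>Here \<open>?K b a\<close> sends \<open>n\<close> to \<open>w a\<close> or, if
    \<open>w a = n\<close>, to \<open>b\<close>. Neither is \<open>n\<close>, whereas a permutation
    of \<open>S\<close> fixes \<open>n\<close>. So only \<open>b = w a\<close> survives, and nothing
    does when \<open>w a = n\<close>.\<close>
  have zero: "num_factorizations S (?K b a) = 0" if "a \<in> S" "b \<in> S" "b \<noteq> w a" for a b
  proof (rule num_factorizations_eq_0)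
    have "w a \<noteq> n \<Longrightarrow> ?K b a n = w a" "w a = n \<Longrightarrow> ?K b a n = b" using that by simp_all
    then have "?K b a n \<noteq> n" using that S by metis
    then show "\<not> ?K b a permutes S" using S permutes_not_in by metis
  qed
  have "num_factorizations (insert n S) w =
      (\<Sum>u\<in>long_cycles (insert n S). \<Sum>(a, v)\<in>S \<times> long_cycles S. of_bool (u \<circ> (v \<circ> transpose a n) = w))"
    unfolding num_factorizations_def sum.reindex_bij_betw[OF long_cycles_insert(1)[OF S], symmetric]
    by (simp add: case_prod_beta)
  also have "\<dots> = (\<Sum>(b, u)\<in>S \<times> long_cycles S. \<Sum>(a, v)\<in>S \<times> long_cycles S.
      of_bool ((transpose b n \<circ> u) \<circ> (v \<circ> transpose a n) = w))"
    unfolding sum.reindex_bij_betw[OF long_cycles_insert(2)[OF S], symmetric]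
    by (simp add: case_prod_beta)
  also have "\<dots> = (\<Sum>b\<in>S. \<Sum>u\<in>long_cycles S. \<Sum>a\<in>S. \<Sum>v\<in>long_cycles S. of_bool (u \<circ> v = ?K b a))"
    unfolding eq sum.cartesian_product[symmetric] ..
  also have "\<dots> = (\<Sum>b\<in>S. \<Sum>a\<in>S. \<Sum>u\<in>long_cycles S. \<Sum>v\<in>long_cycles S. of_bool (u \<circ> v = ?K b a))"
    by (rule sum.cong[OF refl]) (rule sum.swap)
  also have "\<dots> = (\<Sum>a\<in>S. \<Sum>b\<in>S. num_factorizations S (?K b a))"
    unfolding num_factorizations_def by (rule sum.swap)
  also have "\<dots> = (\<Sum>a\<in>S. if w a \<noteq> n then num_factorizations S (?K (w a) a) else 0)"
  proof (rule sum.cong[OF refl])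
    fix a assume a: "a \<in> S"
    have "(\<Sum>b\<in>S. num_factorizations S (?K b a)) =
        (\<Sum>b\<in>S. if b = w a then num_factorizations S (?K (w a) a) else 0)"
      using zero[OF a] by (intro sum.cong) auto
    also have "\<dots> = (if w a \<in> S then num_factorizations S (?K (w a) a) else 0)"
      using S(1) by (simp add: sum.delta')
    also have "w a \<in> S \<longleftrightarrow> w a \<noteq> n"
      using permutes_in_image[OF w, of a] a S(3) by auto
    finally show "(\<Sum>b\<in>S. num_factorizations S (?K b a)) =
        (if w a \<noteq> n then num_factorizations S (?K (w a) a) else 0)" .
  qed
  also have "\<dots> = (\<Sum>a\<in>{a \<in> S. w a \<noteq> n}. num_factorizations S (?K (w a) a))"
    using S(1) by (simp add: sum.inter_filter)
  finally show ?thesis .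
qed

text \<open>Since \<open>w\<close> fixes \<open>n\<close>, the two transpositions cancel across it,
  and each \<open>a\<close> gives back \<open>w\<close> itself.\<close>

lemma num_factorizations_fixpoint:
  assumes S: "finite S" "S \<noteq> {}" "n \<notin> S" and w: "w permutes S"
  shows "num_factorizations (insert n S) w = card S * num_factorizations S w"
proof -
  have "{a \<in> S. w a \<noteq> n} = S" using permutes_in_image[OF w] S(3) by auto
  moreover have "transpose (w a) n \<circ> w \<circ> transpose a n = w" for a
    using transpose_comp_permutes[OF w S(3)] comp_transpose_cancel by metis
  moreover have "w permutes insert n S" using w by (rule permutes_subset) auto
  ultimately show ?thesis using num_factorizations_insert[OF S] by simp
qed

text \<open>The value \<open>a = m\<close> drops out because it is sent to \<open>n\<close>.
  Otherwise, moving the left transposition through \<open>p\<close> leaves the conjugate of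
  \<open>transpose n m\<close> by \<open>transpose a n\<close>, which is
  \<open>transpose a m\<close>.\<close>

lemma num_factorizations_comp_transpose:
  assumes S: "finite S" "n \<notin> S" and p: "p permutes S" and m: "m \<in> S"
  shows "num_factorizations (insert n S) (p \<circ> transpose m n) =
    (\<Sum>a\<in>S - {m}. num_factorizations S (p \<circ> transpose a m))"
proof -
  let ?w = "p \<circ> transpose m n"
  have pn: "p n = n" using p S(2) by (rule permutes_not_in)
  have w_other: "?w a = p a" if a: "a \<in> S - {m}" for a
  proof -
    have "a \<noteq> m" "a \<noteq> n" using a S(2) by auto
    then show ?thesis by simp
  qed
  have "p a \<noteq> n" if "a \<in> S" for a using permutes_in_image[OF p] that S(2) by auto
  then have set: "{a \<in> S. ?w a \<noteq> n} = S - {m}"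
    using w_other pn by auto
  have conj: "transpose (?w a) n \<circ> ?w \<circ> transpose a n = p \<circ> transpose a m" if a: "a \<in> S - {m}" for a
  proof -
    have "transpose (?w a) n \<circ> ?w \<circ> transpose a n = (transpose (p a) n \<circ> p) \<circ> transpose m n \<circ> transpose a n"
      unfolding w_other[OF a] by (simp add: comp_assoc)
    also have "\<dots> = p \<circ> (transpose a n \<circ> transpose n m \<circ> transpose a n)"
      unfolding transpose_comp_permutes[OF p S(2)] by (simp add: comp_assoc transpose_commute[of m n])
    also have "transpose a n \<circ> transpose n m \<circ> transpose a n = transpose a m"
      using a m S(2) by (intro transpose_comp_triple) auto
    finally show ?thesis .
  qed
  have "?w permutes insert n S" using p m by (rule permutes_insert_comp)
  then show ?thesis
    using num_factorizations_insert[of S n ?w] S m set conj by auto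
qed

lemma permutes_insert_cases:
  assumes w: "w permutes insert n S" and n: "n \<notin> S"
  obtains "w permutes S" | m p where "m \<in> S" "p permutes S" "w = p \<circ> transpose m n"
proof -
  obtain m where m: "w m = n" "m \<in> insert n S"
    using permutes_image[OF w] by (metis imageE insertI1)
  show ?thesis
  proof (cases "m = n")
    case True
    then have "w permutes S" using permutes_insert_removal[OF w n m(1)] by simp
    then show ?thesis by (rule that(1))
  next
    case False
    then show ?thesis
      using that(2)[of m "w \<circ> transpose m n"] m permutes_insert_removal[OF w n m(1)]
        comp_transpose_cancel[of w m n] by auto
  qed
qed

lemma cycle_weight_insert:
  assumes p: "p permutes S" and S: "finite S" and "m \<in> S" "n \<notin> S"
  shows "cycle_weight (p \<circ> transpose m n) (insert n S) =
    hpoly (Suc (card (orbit p m))) * (\<Prod>C\<in>cycles p S - {orbit p m}. hpoly (card C))"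
proof -
  have n: "n \<notin> C" if "C \<in> cycles p S" for C using Union_cycles[OF p S] that assms(4) by auto
  have o: "orbit p m \<in> cycles p S" using orbit_in_cycles[OF p S] assms(3) .
  have "insert n (orbit p m) \<notin> cycles p S - {orbit p m}" using n by blast
  moreover have "card (insert n (orbit p m)) = Suc (card (orbit p m))"
    using n[OF o] finite_in_cycles[OF p S o] by simp
  ultimately show ?thesis
    unfolding cycle_weight_def cycles_insert(1)[OF assms] using finite_cycles[OF p S] by simp
qed

lemma cycle_weight_fixpoint:
  assumes "p permutes S" "finite S" "n \<notin> S"
  shows "cycle_weight p (insert n S) = cycle_weight p S"
  unfolding cycle_weight_def cycles_insert_fixpoint[OF assms]
  using finite_cycles[OF assms(1,2)] singleton_notin_cycles[OF assms] by simp

text \<open>Boccara's formula. A fixed new point adds the factor \<open>hpoly 1 = 1\<close> to the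
  weight, and the factor \<open>card S\<close> is absorbed by the factorial; a new point after some
  \<open>m\<close> is the case of the common recursion.\<close>

lemma num_factorizations_eq_pint:
  assumes "finite S" "S \<noteq> {}" "w permutes S"
  shows "real (num_factorizations S w) = fact (card S - 1) * pint (cycle_weight w S)"
  using assms
proof (induction arbitrary: w rule: finite_ne_induct)
  case (singleton x)
  then have w: "w = id" by simp
  have p: "pint 1 = 1" using pint_beta[of 0 0] by simp
  have "orbit id x = {x}" by (simp add: orbit_eq_singleton_iff)
  then have c: "cycle_weight id {x} = 1"
    unfolding cycle_weight_def cycles_def image_insert image_empty by simp
  have f: "num_factorizations {x} id = 1"
    unfolding num_factorizations_def long_cycles_singleton by simp
  show ?case unfolding w c f p by simp
next
  case (insert n S)
  note S = \<open>finite S\<close> \<open>S \<noteq> {}\<close> \<open>n \<notin> S\<close>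
  have fact: "real (card S) * fact (card S - 1) = fact (card (insert n S) - 1)"
    using S by (simp add: fact_reduce card_gt_0_iff)
  from \<open>w permutes insert n S\<close> \<open>n \<notin> S\<close> show ?case
  proof (cases rule: permutes_insert_cases)
    case 1
    then show ?thesis
      unfolding num_factorizations_fixpoint[OF S 1] cycle_weight_fixpoint[OF 1 S(1,3)] fact[symmetric]
      by (simp add: insert.IH)
  next
    case (2 m p)
    have "real (num_factorizations (insert n S) w) =
        (\<Sum>a\<in>S - {m}. fact (card S - 1) * pint (cycle_weight (p \<circ> transpose a m) S))"
      unfolding 2(3) num_factorizations_comp_transpose[OF S(1,3) 2(2,1)] of_nat_sum
    proof (rule sum.cong[OF refl])
      fix a assume "a \<in> S - {m}"
      then have "p \<circ> transpose a m permutes S"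
        using 2 by (intro permutes_compose permutes_swap_id) auto
      then show "real (num_factorizations S (p \<circ> transpose a m)) =
          fact (card S - 1) * pint (cycle_weight (p \<circ> transpose a m) S)" by (rule insert.IH)
    qed
    also have "\<dots> = fact (card (insert n S) - 1) * pint (cycle_weight w (insert n S))"
      unfolding sum_distrib_left[symmetric] pint_cycle_weight_transpositions[OF 2(2) S(1) 2(1)]
        2(3) cycle_weight_insert[OF 2(2) S(1) 2(1) S(3)] fact[symmetric]
      by (simp only: mult_ac)
    finally show ?thesis .
  qed
qed

section \<open>Summation over permutations with marked points in one cycle\<close>

definition cycle_weight_total :: "'a set \<Rightarrow> real poly" where
  "cycle_weight_total S = (\<Sum>w | w permutes S. cycle_weight w S)"

definition rooted_weight :: "(nat \<Rightarrow> real poly) \<Rightarrow> 'a \<Rightarrow> 'a set \<Rightarrow> ('a \<Rightarrow> 'a) \<Rightarrow> real poly" where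
  "rooted_weight g r T w =
    g (card (orbit w r)) * (\<Prod>C\<in>cycles w T - {orbit w r}. hpoly (card C))"

definition rooted_weight_total :: "(nat \<Rightarrow> real poly) \<Rightarrow> 'a \<Rightarrow> 'a set \<Rightarrow> 'a set \<Rightarrow> real poly" where
  "rooted_weight_total g r S M =
    (\<Sum>w | w permutes insert r S \<and> M \<subseteq> orbit w r. rooted_weight g r (insert r S) w)"

text \<open>With \<open>m\<close> points besides the root, \<open>k\<close> of them marked, a cycle
  of length \<open>l\<close> through the root and all marks can be chosen in (m - k)! (l - 1)! / ((l
  - 1 - k)! (m + 1 - l)!) ways, and the other points contribute (m + 1 - l)!
  \<open>polyX ^ (m - l)\<close>. The common factor k! (m - k)! is left out. The last term stands
  apart because an empty rest contributes 1.\<close>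

definition rooted_poly :: "nat \<Rightarrow> nat \<Rightarrow> (nat \<Rightarrow> real poly) \<Rightarrow> real poly" where
  "rooted_poly k m g = (\<Sum>l=1..m. of_nat ((l - 1) choose k) * (g l * polyX ^ (m - l)))
    + of_nat (m choose k) * g (Suc m)"

lemma rooted_weight_hpoly:
  assumes "w permutes T" "finite T" "r \<in> T"
  shows "rooted_weight hpoly r T w = cycle_weight w T"
  unfolding rooted_weight_def cycle_weight_def
  using finite_cycles[OF assms(1,2)] orbit_in_cycles[OF assms] by (simp add: prod.remove)

lemma rooted_weight_total_hpoly:
  "finite S \<Longrightarrow> rooted_weight_total hpoly r S M =
    (\<Sum>w | w permutes insert r S \<and> M \<subseteq> orbit w r. cycle_weight w (insert r S))"
  unfolding rooted_weight_total_def by (rule sum.cong) (auto simp: rooted_weight_hpoly)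

lemma permutes_insert_root:
  assumes r: "r \<notin> S"
  shows "{w. w permutes insert r S} = {w. w permutes S} \<union>
    (\<Union>s\<in>S. (\<lambda>p. p \<circ> transpose r s) ` {p. p permutes insert r (S - {s})})"
proof (intro equalityI subsetI)
  fix w assume "w \<in> {w. w permutes insert r S}"
  then have w: "w permutes insert r S" by simp
  show "w \<in> {w. w permutes S} \<union>
    (\<Union>s\<in>S. (\<lambda>p. p \<circ> transpose r s) ` {p. p permutes insert r (S - {s})})"
  proof (cases "w r = r")
    case True
    then have "w permutes S" using w by (auto intro: permutes_superset)
    then show ?thesis by simp
  next
    case False
    then have s: "w r \<in> S" using permutes_in_image[OF w, of r] by simp
    have "insert (w r) (insert r (S - {w r})) = insert r S" using s by auto
    then have "w \<circ> transpose r (w r) permutes insert r (S - {w r})"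
      using permutes_insert_removal[of w "w r" "insert r (S - {w r})" r] w False by simp
    then show ?thesis
      using s comp_transpose_cancel[of w r "w r", symmetric] by blast
  qed
next
  fix w assume "w \<in> {w. w permutes S} \<union>
    (\<Union>s\<in>S. (\<lambda>p. p \<circ> transpose r s) ` {p. p permutes insert r (S - {s})})"
  then consider "w permutes S" | s p where "s \<in> S" "p permutes insert r (S - {s})" "w = p \<circ> transpose r s"
    by auto
  then show "w \<in> {w. w permutes insert r S}"
  proof cases
    case 1
    then show ?thesis using permutes_subset[of w S "insert r S"] by auto
  next
    case 2
    then have "insert s (insert r (S - {s})) = insert r S" by auto
    then show ?thesis using 2 permutes_insert_comp[OF 2(2), of r s] by simp
  qed
qed

text \<open>The permutations are sorted by the successor \<open>s\<close> of the root. If the root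
  is fixed, its cycle contains no marked point, so \<open>M\<close> has to be empty. Otherwise
  \<open>s\<close> is contracted: the cycle of the root loses one point, which shifts
  \<open>g\<close>, and \<open>s\<close> leaves the set of marks.\<close>

lemma rooted_weight_total_rec:
  assumes S: "finite S" "r \<notin> S" and M: "M \<subseteq> S"
  shows "rooted_weight_total g r S M = (if M = {} then g 1 * cycle_weight_total S else 0)
    + (\<Sum>s\<in>S. rooted_weight_total (g \<circ> Suc) r (S - {s}) (M - {s}))"
proof -
  let ?T = "insert r S"
  define f where "f w = (if M \<subseteq> orbit w r then rooted_weight g r ?T w else 0)" for w
  define P where "P s = {p. p permutes insert r (S - {s})}" for s
  define A where "A s = (\<lambda>p. p \<circ> transpose r s) ` P s" for s
  have finT: "finite ?T" using S by simp
  have finP: "finite (P s)" for s unfolding P_def using S by (intro finite_permutations) auto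
  have fixs: "p s = s" if "p \<in> P s" "s \<in> S" for p s
    using that S(2) unfolding P_def by (auto intro: permutes_not_in)
  have A_r: "w r = s" if "w \<in> A s" "s \<in> S" for w s
    using that fixs by (auto simp: A_def)
  have inj: "inj_on (\<lambda>p. p \<circ> transpose r s) (P s)" for s
    by (rule inj_onI) (metis comp_transpose_cancel)
  have "rooted_weight_total g r S M = (\<Sum>w | w permutes ?T. f w)"
    unfolding rooted_weight_total_def f_def
    using finite_permutations[OF finT] by (simp add: sum.If_cases Collect_conj_eq Int_commute Collect_mono_iff)
  also have "{w. w permutes ?T} = {w. w permutes S} \<union> (\<Union>s\<in>S. A s)"
    unfolding A_def P_def by (rule permutes_insert_root[OF S(2)])
  also have "(\<Sum>w\<in>\<dots>. f w) = (\<Sum>w | w permutes S. f w) + (\<Sum>w\<in>(\<Union>s\<in>S. A s). f w)"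
  proof (rule sum.union_disjoint)
    show "finite {w. w permutes S}" using finite_permutations[OF S(1)] .
    show "finite (\<Union>s\<in>S. A s)" using S(1) finP by (simp add: A_def)
    have "w r = r" if "w permutes S" for w using that S(2) by (rule permutes_not_in)
    then show "{w. w permutes S} \<inter> (\<Union>s\<in>S. A s) = {}" using A_r S(2) by fastforce
  qed
  also have "(\<Sum>w\<in>(\<Union>s\<in>S. A s). f w) = (\<Sum>s\<in>S. \<Sum>w\<in>A s. f w)"
  proof (rule sum.UNION_disjoint)
    show "finite S" by fact
    show "\<forall>s\<in>S. finite (A s)" using finP by (simp add: A_def)
    show "\<forall>s\<in>S. \<forall>t\<in>S. s \<noteq> t \<longrightarrow> A s \<inter> A t = {}"
    proof (intro ballI impI)
      fix s t assume "s \<in> S" "t \<in> S" "s \<noteq> t"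
      then show "A s \<inter> A t = {}" using A_r by blast
    qed
  qed
  also have "(\<Sum>w | w permutes S. f w) = (if M = {} then g 1 * cycle_weight_total S else 0)"
  proof -
    have "f w = (if M = {} then g 1 * cycle_weight w S else 0)" if w: "w permutes S" for w
    proof -
      have o: "orbit w r = {r}" using permutes_not_in[OF w S(2)] by (simp add: orbit_eq_singleton_iff)
      have "M \<subseteq> {r} \<longleftrightarrow> M = {}" using M S(2) by auto
      moreover have "cycles w ?T - {{r}} = cycles w S"
        using cycles_insert_fixpoint[OF w S] singleton_notin_cycles[OF w S] by simp
      ultimately show ?thesis unfolding f_def rooted_weight_def o cycle_weight_def by simp
    qed
    then have "(\<Sum>w | w permutes S. f w) = (\<Sum>w | w permutes S. if M = {} then g 1 * cycle_weight w S else 0)"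
      by (intro sum.cong) auto
    then show ?thesis by (simp add: cycle_weight_total_def sum_distrib_left)
  qed
  also have "(\<Sum>s\<in>S. \<Sum>w\<in>A s. f w) = (\<Sum>s\<in>S. rooted_weight_total (g \<circ> Suc) r (S - {s}) (M - {s}))"
  proof (rule sum.cong[OF refl])
    fix s assume s: "s \<in> S"
    let ?U = "insert r (S - {s})"
    have U: "finite ?U" "s \<notin> ?U" "r \<in> ?U" "insert s ?U = ?T" using S s by auto
    have "f (p \<circ> transpose r s) = (if M - {s} \<subseteq> orbit p r then rooted_weight (g \<circ> Suc) r ?U p else 0)"
      if p: "p permutes ?U" for p
    proof -
      have c: "cycles (p \<circ> transpose r s) ?T = insert (insert s (orbit p r)) (cycles p ?U - {orbit p r})"
        and o: "orbit (p \<circ> transpose r s) r = insert s (orbit p r)"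
        using cycles_insert[OF p U(1) U(3) U(2)] unfolding U(4) by auto
      have s_notin: "s \<notin> C" if "C \<in> cycles p ?U" for C using Union_cycles[OF p U(1)] that U(2) by auto
      have orb: "orbit p r \<in> cycles p ?U" using orbit_in_cycles[OF p U(1) U(3)] .
      have "cycles (p \<circ> transpose r s) ?T - {insert s (orbit p r)} = cycles p ?U - {orbit p r}"
        unfolding c using s_notin by auto
      moreover have "card (insert s (orbit p r)) = Suc (card (orbit p r))"
        using s_notin[OF orb] finite_in_cycles[OF p U(1) orb] by simp
      moreover have "M \<subseteq> insert s (orbit p r) \<longleftrightarrow> M - {s} \<subseteq> orbit p r" by auto
      ultimately show ?thesis unfolding f_def rooted_weight_def o by simp
    qed
    then have "(\<Sum>w\<in>A s. f w) = (\<Sum>p\<in>P s. if M - {s} \<subseteq> orbit p r then rooted_weight (g \<circ> Suc) r ?U p else 0)"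
      unfolding A_def sum.reindex[OF inj] by (intro sum.cong) (auto simp: P_def)
    also have "\<dots> = rooted_weight_total (g \<circ> Suc) r (S - {s}) (M - {s})"
      using finP[of s] unfolding rooted_weight_total_def P_def
      by (simp add: sum.If_cases Collect_conj_eq Int_commute)
    finally show "(\<Sum>w\<in>A s. f w) = rooted_weight_total (g \<circ> Suc) r (S - {s}) (M - {s})" .
  qed
  finally show ?thesis .
qed

lemma rooted_poly_Suc:
  "rooted_poly k (Suc m) g = of_nat (0 choose k) * (g 1 * polyX ^ m)
    + ((\<Sum>l=1..m. of_nat (l choose k) * (g (Suc l) * polyX ^ (m - l))) + of_nat (Suc m choose k) * g (Suc (Suc m)))"
proof -
  have "sum F {Suc 0..Suc m} = F (Suc 0) + (\<Sum>l=Suc 0..m. F (Suc l))" for F :: "nat \<Rightarrow> real poly"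
  proof -
    have "sum F {Suc 0..Suc m} = F (Suc 0) + sum F {Suc (Suc 0)..Suc m}"
      by (rule sum.atLeast_Suc_atMost) simp
    then show ?thesis by (simp only: sum.shift_bounds_cl_Suc_ivl)
  qed
  then show ?thesis unfolding rooted_poly_def One_nat_def by (simp only: diff_Suc_Suc diff_zero add.assoc)
qed

lemma rooted_poly_0_Suc: "rooted_poly 0 (Suc m) g = g 1 * polyX ^ m + rooted_poly 0 m (g \<circ> Suc)"
  unfolding rooted_poly_Suc by (simp add: rooted_poly_def)

text \<open>Pascal's rule; its two terms correspond to a marked and an unmarked successor of the
  root.\<close>

lemma rooted_poly_Suc_Suc:
  "rooted_poly (Suc k) (Suc m) g = rooted_poly k m (g \<circ> Suc) + rooted_poly (Suc k) m (g \<circ> Suc)"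
proof -
  have "(\<Sum>l=1..m. of_nat (l choose Suc k) * (g (Suc l) * polyX ^ (m - l))) =
      (\<Sum>l=1..m. of_nat ((l - 1) choose k) * (g (Suc l) * polyX ^ (m - l))
        + of_nat ((l - 1) choose Suc k) * (g (Suc l) * polyX ^ (m - l)))"
  proof (rule sum.cong[OF refl])
    fix l assume "l \<in> {1..m}"
    then obtain i where "l = Suc i" by (metis atLeastAtMost_iff Suc_le_D One_nat_def)
    then show "of_nat (l choose Suc k) * (g (Suc l) * polyX ^ (m - l)) =
      of_nat ((l - 1) choose k) * (g (Suc l) * polyX ^ (m - l))
        + of_nat ((l - 1) choose Suc k) * (g (Suc l) * polyX ^ (m - l))"
      by (simp add: distrib_right)
  qed
  then show ?thesis
    unfolding rooted_poly_Suc unfolding rooted_poly_def by (simp add: sum.distrib algebra_simps)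
qed

lemma rooted_poly_eq_0: "m < k \<Longrightarrow> rooted_poly k m g = 0"
  unfolding rooted_poly_def by (auto simp: binomial_eq_0 intro!: sum.neutral)

text \<open>Without marks and with \<open>g = hpoly\<close> the rooted weight is the plain cycle
  weight, so this yields its total over all permutations. The result agrees with the generating
  function exp (\<Sum> \<open>hpoly l\<close> z^l / l) = (1 - (x - 1) z) / (1 - x z) = 1 + z / (1 -
  x z).\<close>

lemma rooted_poly_hpoly: "rooted_poly 0 m hpoly = of_nat (Suc m) * polyX ^ m"
proof (induction m)
  case 0
  then show ?case by (simp add: rooted_poly_def)
next
  case (Suc m)
  define s where "s = (\<Sum>l=1..m. hpoly l * polyX ^ (m - l))"
  have s: "s = of_nat (Suc m) * polyX ^ m - hpoly (Suc m)"
    using Suc by (simp add: rooted_poly_def s_def algebra_simps)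
  have "(\<Sum>l=1..m. hpoly l * polyX ^ (Suc m - l)) = polyX * s"
    unfolding s_def sum_distrib_left by (rule sum.cong) (auto simp: Suc_diff_le)
  then have "rooted_poly 0 (Suc m) hpoly = polyX * s + hpoly (Suc m) + hpoly (Suc (Suc m))"
    by (simp add: rooted_poly_def)
  also have "\<dots> = polyX * of_nat (Suc m) * polyX ^ m + (1 + polyY - polyX) * hpoly (Suc m) + polyX ^ Suc m"
    unfolding s hpoly_Suc[of "Suc m"] by (simp add: algebra_simps)
  also have "1 + polyY - polyX = 0" by (simp add: polyX_eq)
  finally show ?case by (simp add: algebra_simps)
qed

lemma rooted_weight_total_eq:
  assumes "finite S" "r \<notin> S" "M \<subseteq> S"
  shows "rooted_weight_total g r S M =
    of_nat (fact (card M) * fact (card S - card M)) * rooted_poly (card M) (card S) g"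
  using assms
proof (induction "card S" arbitrary: S r M g)
  case 0
  then have "S = {}" "M = {}" by auto
  moreover have "cycle_weight_total ({} :: 'a set) = 1"
    by (simp add: cycle_weight_total_def cycle_weight_def cycles_def)
  ultimately show ?case
    using rooted_weight_total_rec[of S r M g] 0 by (simp add: rooted_poly_def)
next
  case (Suc m)
  have finM: "finite M" using Suc.prems finite_subset by blast
  \<comment> \<open>The induction hypothesis serves here as well: any point of \<open>S\<close> is
    taken as a root for the remaining \<open>m\<close> points.\<close>
  have total: "cycle_weight_total S = of_nat (fact (Suc m)) * polyX ^ m"
  proof -
    obtain x where x: "x \<in> S" using Suc.hyps(2) by fastforce
    define S' where "S' = S - {x}"
    have S': "insert x S' = S" "m = card S'" "finite S'" "x \<notin> S'"
      using x Suc.hyps(2) Suc.prems(1) by (auto simp: S'_def)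
    have "cycle_weight_total S = rooted_weight_total hpoly x S' {}"
      unfolding rooted_weight_total_hpoly[OF S'(3)] S'(1) cycle_weight_total_def by simp
    also have "\<dots> = of_nat (fact m) * rooted_poly 0 m hpoly"
      using Suc.hyps(1)[of S' x "{}" hpoly] S' by simp
    finally show ?thesis unfolding rooted_poly_hpoly by (simp add: algebra_simps)
  qed
  have IH: "rooted_weight_total (g \<circ> Suc) r (S - {s}) (M - {s}) =
      of_nat (fact (card (M - {s})) * fact (m - card (M - {s}))) * rooted_poly (card (M - {s})) m (g \<circ> Suc)"
    if "s \<in> S" for s
  proof -
    have "m = card (S - {s})" using that Suc.hyps(2) Suc.prems(1) by simp
    then show ?thesis using Suc.hyps(1)[of "S - {s}" r "M - {s}" "g \<circ> Suc"] Suc.prems by auto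
  qed
  define k where "k = card M"
  have km: "k \<le> Suc m" unfolding k_def Suc.hyps(2) using Suc.prems by (intro card_mono)
  have cardSM: "card (S - M) = Suc m - k"
    unfolding k_def Suc.hyps(2) using Suc.prems finM by (simp add: card_Diff_subset)
  have notM: "(\<Sum>s\<in>S - M. rooted_weight_total (g \<circ> Suc) r (S - {s}) (M - {s})) =
      of_nat (Suc m - k) * (of_nat (fact k * fact (m - k)) * rooted_poly k m (g \<circ> Suc))"
  proof -
    have "rooted_weight_total (g \<circ> Suc) r (S - {s}) (M - {s}) =
        of_nat (fact k * fact (m - k)) * rooted_poly k m (g \<circ> Suc)" if "s \<in> S - M" for s
      using IH[of s] that by (simp add: k_def)
    then show ?thesis unfolding cardSM[symmetric] by simp
  qed
  \<comment> \<open>For \<open>k = 0\<close> the truncated \<open>k - 1\<close> is harmless, as the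
    factor \<open>of_nat k\<close> is 0.\<close>
  have inM: "(\<Sum>s\<in>M. rooted_weight_total (g \<circ> Suc) r (S - {s}) (M - {s})) =
      of_nat k * (of_nat (fact (k - 1) * fact (m - (k - 1))) * rooted_poly (k - 1) m (g \<circ> Suc))"
    using IH Suc.prems(3) finM by (simp add: k_def subset_iff)
  have "(\<Sum>s\<in>S. rooted_weight_total (g \<circ> Suc) r (S - {s}) (M - {s})) =
      of_nat (Suc m - k) * (of_nat (fact k * fact (m - k)) * rooted_poly k m (g \<circ> Suc))
      + of_nat k * (of_nat (fact (k - 1) * fact (m - (k - 1))) * rooted_poly (k - 1) m (g \<circ> Suc))"
    unfolding sum.subset_diff[OF Suc.prems(3,1)] notM inM ..
  also have "of_nat (Suc m - k) * (of_nat (fact k * fact (m - k)) * rooted_poly k m (g \<circ> Suc)) =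
      of_nat (fact k * fact (Suc m - k)) * rooted_poly k m (g \<circ> Suc)"
  \<comment> \<open>If every point is marked, the factor on the left is 0 but the factorials on the
    right are not; there \<open>rooted_poly k m\<close> vanishes.\<close>
  proof (cases "k = Suc m")
    case True
    then show ?thesis by (simp add: rooted_poly_eq_0)
  next
    case False
    then have "Suc m - k = Suc (m - k)" using km by simp
    then show ?thesis by (simp only: fact_Suc of_nat_mult of_nat_id mult_ac)
  qed
  finally have sum: "(\<Sum>s\<in>S. rooted_weight_total (g \<circ> Suc) r (S - {s}) (M - {s})) =
      of_nat (fact k * fact (Suc m - k)) * rooted_poly k m (g \<circ> Suc)
      + of_nat k * (of_nat (fact (k - 1) * fact (m - (k - 1))) * rooted_poly (k - 1) m (g \<circ> Suc))" .
  have rec: "rooted_weight_total g r S M =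
      (if k = 0 then g 1 * (of_nat (fact (Suc m)) * polyX ^ m) else 0)
      + (of_nat (fact k * fact (Suc m - k)) * rooted_poly k m (g \<circ> Suc)
      + of_nat k * (of_nat (fact (k - 1) * fact (m - (k - 1))) * rooted_poly (k - 1) m (g \<circ> Suc)))"
    unfolding rooted_weight_total_rec[OF Suc.prems] total sum using finM by (simp add: k_def)
  show ?case
  proof (cases k)
    case 0
    then show ?thesis unfolding rec k_def[symmetric] Suc.hyps(2)[symmetric]
      by (simp add: rooted_poly_0_Suc algebra_simps)
  next
    case (Suc j)
    then show ?thesis unfolding rec k_def[symmetric] Suc.hyps(2)[symmetric]
      using km by (simp add: rooted_poly_Suc_Suc algebra_simps)
  qed
qed

section \<open>From counting factorizations to the probability\<close>

lemma in_same_cycle_iff_orbit: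
  assumes "w permutes S" "finite S"
  shows "in_same_cycle w (insert r M) \<longleftrightarrow> M \<subseteq> orbit w r"
proof
  assume "in_same_cycle w (insert r M)"
  then obtain C where "cyclic_on w C" "insert r M \<subseteq> C" unfolding in_same_cycle_def by blast
  then show "M \<subseteq> orbit w r" using orbit_cyclic_eq3[of w C r] by auto
next
  assume "M \<subseteq> orbit w r"
  then have "insert r M \<subseteq> orbit w r" using self_in_orbit[OF assms] by simp
  then show "in_same_cycle w (insert r M)"
    unfolding in_same_cycle_def using cyclic_on_orbit[OF assms] by blast
qed

lemma prob_pair_pmf_of_set:
  assumes "finite A" "A \<noteq> {}"
  shows "measure_pmf.prob (pair_pmf (pmf_of_set A) (pmf_of_set A)) {(u, v). P u v} =
    real (\<Sum>u\<in>A. \<Sum>v\<in>A. of_bool (P u v)) / (real (card A))\<^sup>2"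
proof -
  have fin: "finite (A \<times> A)" using assms by simp
  have pair: "pair_pmf (pmf_of_set A) (pmf_of_set A) = pmf_of_set (A \<times> A)"
  proof (rule pmf_eqI)
    fix x :: "'a \<times> 'a"
    show "pmf (pair_pmf (pmf_of_set A) (pmf_of_set A)) x = pmf (pmf_of_set (A \<times> A)) x"
      using assms fin by (cases x) (simp add: pmf_pair card_cartesian_product indicator_def)
  qed
  have "card ((A \<times> A) \<inter> {(u, v). P u v}) = (\<Sum>(u, v)\<in>A \<times> A. of_bool (P u v))"
    using fin by (simp add: case_prod_beta sum.If_cases of_bool_def Int_def)
  also have "\<dots> = (\<Sum>u\<in>A. \<Sum>v\<in>A. of_bool (P u v))"
    by (simp only: sum.cartesian_product)
  finally show ?thesis
    unfolding pair using assms fin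
    by (simp add: measure_pmf_of_set card_cartesian_product power2_eq_square)
qed

lemma sum_num_factorizations:
  assumes "finite S"
  shows "(\<Sum>u\<in>long_cycles S. \<Sum>v\<in>long_cycles S. of_bool (P (u \<circ> v))) =
    (\<Sum>w | w permutes S \<and> P w. num_factorizations S w)"
proof -
  have fin: "finite {w. w permutes S \<and> P w}"
    using finite_permutations[OF assms] by (rule rev_finite_subset) auto
  have "(\<Sum>w | w permutes S \<and> P w. num_factorizations S w) =
      (\<Sum>u\<in>long_cycles S. \<Sum>w | w permutes S \<and> P w. \<Sum>v\<in>long_cycles S. of_bool (u \<circ> v = w))"
    unfolding num_factorizations_def by (rule sum.swap)
  also have "\<dots> = (\<Sum>u\<in>long_cycles S. \<Sum>v\<in>long_cycles S. \<Sum>w | w permutes S \<and> P w. of_bool (u \<circ> v = w))"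
    by (rule sum.cong[OF refl]) (rule sum.swap)
  also have "\<dots> = (\<Sum>u\<in>long_cycles S. \<Sum>v\<in>long_cycles S. of_bool (P (u \<circ> v)))"
  proof (intro sum.cong refl)
    fix u v assume "u \<in> long_cycles S" "v \<in> long_cycles S"
    then have "u \<circ> v permutes S" by (auto simp: long_cycles_def intro: permutes_compose)
    then show "(\<Sum>w | w permutes S \<and> P w. of_bool (u \<circ> v = w)) = of_bool (P (u \<circ> v))"
      using fin by (simp add: of_bool_def sum.delta)
  qed
  finally show ?thesis by simp
qed

theorem theorem2:
  fixes n :: nat
  assumes "n \<ge> 3"
  shows "pi3 n =
    (if odd n then 1 / 3 + 1 / ((real n - 2) * (real n + 3))
     else 1 / 3 - 3 / ((real n - 1) * (real n + 2)))"
proof -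
  let ?S = "{1..n}" and ?A = "{2..n}"
  \<comment> \<open>The point 1 will be the root, so \<open>N\<close> counts the remaining points,
    among them the marks 2 and 3.\<close>
  define N where "N = n - 1"
  have n: "n = Suc N" "2 \<le> N" using assms by (auto simp: N_def)
  have S: "finite ?S" "?S \<noteq> {}" "card ?S = n" "insert 1 ?A = ?S" using assms by auto
  have lc: "n_cycles n = long_cycles ?S" by (simp add: n_cycles_def long_cycles_def)
  have c: "card (long_cycles ?S) = fact N" using card_long_cycles[OF S(1,2)] by (simp add: N_def)
  then have ne: "long_cycles ?S \<noteq> {}" by (metis card.empty fact_nonzero)
  have "real (\<Sum>u\<in>long_cycles ?S. \<Sum>v\<in>long_cycles ?S. of_bool (in_same_cycle (u \<circ> v) {1, 2, 3})) =
      (\<Sum>w | w permutes ?S \<and> in_same_cycle w {1, 2, 3}. fact N * pint (cycle_weight w ?S))"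
    unfolding sum_num_factorizations[OF S(1), of "\<lambda>w. in_same_cycle w {1, 2, 3}"] of_nat_sum
    by (rule sum.cong) (use num_factorizations_eq_pint[OF S(1,2)] in \<open>auto simp: N_def\<close>)
  also have "{w. w permutes ?S \<and> in_same_cycle w {1, 2, 3}} = {w. w permutes ?S \<and> {2, 3} \<subseteq> orbit w 1}"
    using in_same_cycle_iff_orbit[of _ ?S 1 "{2, 3}"] by auto
  also have "(\<Sum>w\<in>\<dots>. fact N * pint (cycle_weight w ?S)) = fact N * pint (rooted_weight_total hpoly 1 ?A {2, 3})"
    unfolding rooted_weight_total_hpoly[OF finite_atLeastAtMost] S(4) pint_sum sum_distrib_left ..
  also have "rooted_weight_total hpoly 1 ?A {2, 3} = of_nat (2 * fact (N - 2)) * rooted_poly 2 N hpoly"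
    using rooted_weight_total_eq[of ?A 1 "{2, 3}" hpoly] assms n by (simp add: numeral_2_eq_2)
  also have "fact N * pint (of_nat (2 * fact (N - 2)) * rooted_poly 2 N hpoly) =
      fact N * (2 * fact (N - 2) * pint (rooted_poly 2 N hpoly))"
    unfolding pint_of_nat by simp
  finally have count: "real (\<Sum>u\<in>long_cycles ?S. \<Sum>v\<in>long_cycles ?S. of_bool (in_same_cycle (u \<circ> v) {1, 2, 3})) =
      fact N * (2 * fact (N - 2) * pint (rooted_poly 2 N hpoly))" .
  \<comment> \<open>There are (N!)^2 pairs of cycles, and 2 N! (N - 2)! / (N!)^2 reduces to 2 / (N
    (N - 1)).\<close>
  have "(fact N :: real) = real N * (real N - 1) * fact (N - 2)"
    using n(2) by (simp add: fact_reduce of_nat_diff numeral_2_eq_2)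
  then have "pi3 n = 2 * pint (rooted_poly 2 N hpoly) / (real N * (real N - 1))"
    unfolding pi3_def lc prob_pair_pmf_of_set[OF finite_long_cycles[OF S(1)] ne] count c
    by (simp add: power2_eq_square)
  also have "\<dots> = (if even N then 1 / 3 + 1 / ((real N - 1) * (real N + 4))
     else 1 / 3 - 3 / (real N * (real N + 3)))"
    unfolding rooted_poly_def using n(2) by (rule pint_marked_cycle_sum)
  finally show ?thesis by (simp add: n(1) add.commute)
qed

end
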